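(* In the setting described in the context, suppose that for every mesh parameter $h$ the functional $v^h\mapsto\mathcal G^h(v^h;q)$ has a minimizer $u^h$ over $\mathcal U^h$, with Helmholtz decomposition $\boldsymbol f(u^h)=\nabla q_{u^h}+\nabla^\perp\psi_{u^h}$, and define $$R_{u^h}=\min_{\mu^h\in\mathcal V^h_{\Gamma_I}}\|\nabla^\perp(\mu^h-\psi_{u^h})\|,\qquad\boldsymbol{\mathcal S}^h=\operatorname{span}\{\boldsymbol f(v^h):v^h\in\mathcal U^h\}\subset[L^2(\Omega)]^2,$$ $$\boldsymbol{\mathcal R}^h=\Big\{\boldsymbol s^h\in\boldsymbol{\mathcal S}^h:\ \min_{\mu^h\in\mathcal V^h_{\Gamma_I}}\|\nabla^\perp(\mu^h-\psi_{\boldsymbol s^h})\|\le2R_{u^{2h}},\ \text{where }\boldsymbol s^h=\nabla q_{\boldsymbol s^h}+\nabla^\perp\psi_{\boldsymbol s^h}\Big\}$$ (the last for those $h$ for which $2h$ is also a mesh parameter; $u^{2h}$ is the minimizer for mesh parameter $2h$). Assume that there are constants $C,c,\varkappa,\gamma>0$, independent of $h$, with $\varkappa>\gamma$, such that $$\|\nabla_{\mathfrak d}\cdot\boldsymbol f(u^h)-\ell_d\|_{-1,\Gamma_C}=\|\nabla(q_{u^h}-q)\|\le Ch^\varkappa$$ and $$\inf_{0\ne\boldsymbol r^h\in\boldsymbol{\mathcal R}^h}\ \sup_{0\ne p\in H^1_{0,\Gamma_C}(\Omega)}\frac{|(\boldsymbol r^h,\nabla p)|}{\|\boldsymbol r^h\|\,\|\nabla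 p\|}\ge ch^\gamma.$$ Assume that the spaces $\mathcal U^h$ and the spaces $\mathcal V^h_{\Gamma_I}$ form respective increasing sequences of nested spaces as $h\to0$, and that $R_{u^h}\le R_{u^{2h}}$ for all sufficiently small $h$. Then $\boldsymbol f(u^h)$ converges in $[L^2(\Omega)]^2$ as $h\to0$, with rate $\mathcal O(h^{\varkappa-\gamma})$; that is, there are $\boldsymbol w\in[L^2(\Omega)]^2$ and a constant $C'>0$ independent of $h$ with $\|\boldsymbol f(u^h)-\boldsymbol w\|\le C'h^{\varkappa-\gamma}$ for all sufficiently small $h$.
   Context: **Domain and spaces.** $\Omega\subset\mathbb R^2$ (coordinates $(t,x)$) is open, bounded, simply connected with Lipschitz boundary $\Gamma$ and unit outward normal $\boldsymbol n$. $\nabla v=[\partial_t v,\partial_x v]$, $\nabla^\perp v=[\partial_x v,-\partial_t v]$. $\|\cdot\|$ and $(\cdot,\cdot)$ are the norm and inner product in $L^2(\Omega)$ and $[L^2(\Omega)]^2$. $\Gamma=\overline{\Gamma_I}\cup\overline{\Gamma_C}$, where $\Gamma_I$ (the inflow part of the boundary, regarded as given) and $\Gamma_C$ are disjoint relatively open subcurves of nonzero measure with finitely many connected components. For $\Gamma_S\subset\Gamma$, $H^1_{0,\Gamma_S}(\Omega)=\{\phi\in H^1(\Omega):\phi=0\text{ on }\Gamma_S\}$ with norm $|\phi|_1=\|\nabla\phi\|$; its dual is $H^{-1}_{\Gamma_S}(\Omega)$ with norm $\|\ell\|_{-1,\Gamma_S}=\sup_{0\ne\phi\in H^1_{0,\Gamma_S}(\Omega)}|\ell(\phi)|/|\phi|_1$.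 **Duality divergence.** For $\boldsymbol v\in[L^2(\Omega)]^2$, $\nabla_{\mathfrak d}\cdot\boldsymbol v\in H^{-1}_{\Gamma_C}(\Omega)$ is the functional $\phi\mapsto-(\boldsymbol v,\nabla\phi)$, $\phi\in H^1_{0,\Gamma_C}(\Omega)$. **Helmholtz decomposition.** Every $\boldsymbol v\in[L^2(\Omega)]^2$ has a unique $L^2$-orthogonal decomposition $\boldsymbol v=\nabla q_{\boldsymbol v}+\nabla^\perp\psi_{\boldsymbol v}$ with $q_{\boldsymbol v}\in H^1_{0,\Gamma_C}(\Omega)$ and $\psi_{\boldsymbol v}\in H^1_{0,\Gamma_I}(\Omega)$, where $(\nabla q_{\boldsymbol v},\nabla\phi)=(\boldsymbol v,\nabla\phi)$ for all $\phi\in H^1_{0,\Gamma_C}(\Omega)$ and $(\nabla^\perp\psi_{\boldsymbol v},\nabla^\perp\nu)=(\boldsymbol v,\nabla^\perp\nu)$ for all $\nu\in H^1_{0,\Gamma_I}(\Omega)$. For $v\in L^\infty(\Omega)$ write $\boldsymbol f(v)=\nabla q_v+\nabla^\perp\psi_v$ for the decomposition of $\boldsymbol f(v)$. **Balance law.** $\nabla\cdot\boldsymbol f(u)=r$ in $\Omega$, $u=g$ on $\Gamma_I$, with $r\in L^2(\Omega)$, $g\in L^\infty(\Gamma_I)$, and $\boldsymbol f=[f_1,f_2]:\mathbb R\to\mathbb R^2$ locally Lipschitz (for every compact $J\subset\mathbb R$ there is $K_{\boldsymbol f,J}>0$ with $|f_i(a)-f_i(b)|\le K_{\boldsymbol f,J}|a-b|$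 for $a,b\in J$, $i=1,2$). The data functional $\ell_d\in H^{-1}_{\Gamma_C}(\Omega)$ is $\ell_d(\phi)=(r,\phi)-\int_{\Gamma_I}\boldsymbol f(g)\cdot\boldsymbol n\,\phi\,d\sigma$. A function $\hat u\in L^\infty(\Omega)$ is a weak solution if $-(\boldsymbol f(\hat u),\nabla\phi)=\ell_d(\phi)$ for all $\phi\in H^1_{0,\Gamma_C}(\Omega)$; a weak solution $\hat u$ is assumed to exist. The function $q\in H^1_{0,\Gamma_C}(\Omega)$ is the gradient component in $\boldsymbol f(\hat u)=\nabla q+\nabla^\perp\psi$; equivalently, it is the unique solution of $(\nabla q,\nabla\phi)=-\ell_d(\phi)$ for all $\phi\in H^1_{0,\Gamma_C}(\Omega)$. **Functionals.** The mesh parameter $h$ runs through $h=2^{-k}h_0$, $k=0,1,2,\dots$, for a fixed $h_0>0$. For each $h$, $\mathcal U^h\subset L^\infty(\Omega)$, $\mathcal V^h_{\Gamma_C}\subset H^1_{0,\Gamma_C}(\Omega)$, $\mathcal V^h_{\Gamma_I}\subset H^1_{0,\Gamma_I}(\Omega)$ are (finite-dimensional) finite element spaces; nestedness means $\mathcal U^{2h}\subset\mathcal U^{h}$ and $\mathcal V^{2h}_{\Gamma_I}\subset\mathcal V^h_{\Gamma_I}$. For $v\in L^\infty(\Omega)$, $p\in H^1_{0,\Gamma_C}(\Omega)$, $\mu\in H^1_{0,\Gamma_I}(\Omega)$, $$\mathcal F(v,p,\mu;q)=\|\boldsymbol f(v)-\nabla p-\nabla^\perp\mu\|^2+\|\nabla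 p-\nabla q\|^2,\qquad \mathcal G^h(v;q)=\min_{p^h\in\mathcal V^h_{\Gamma_C},\,\mu^h\in\mathcal V^h_{\Gamma_I}}\mathcal F(v,p^h,\mu^h;q).$$ *)

theory Defs
  imports "HOL-Analysis.Analysis"
begin

text \<open>Points of the plane are pairs (t, x). Elements of Lebesgue and Sobolev spaces are
  represented by functions; they are identified when equal almost everywhere, and ``nonzero''
  means ``not almost everywhere zero''.\<close>

type_synonym plane = "real \<times> real"


section \<open>Lebesgue spaces\<close>

definition L2 :: "'a measure \<Rightarrow> ('a \<Rightarrow> 'b::euclidean_space) set" where
  "L2 M = {v \<in> borel_measurable M. integrable M (\<lambda>z. (norm (v z))\<^sup>2)}"

definition L2_inner :: "'a measure \<Rightarrow> ('a \<Rightarrow> 'b::euclidean_space) \<Rightarrow> ('a \<Rightarrow> 'b) \<Rightarrow> real" where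
  "L2_inner M v w = (\<integral>z. v z \<bullet> w z \<partial>M)"

definition L2_norm :: "'a measure \<Rightarrow> ('a \<Rightarrow> 'b::euclidean_space) \<Rightarrow> real" where
  "L2_norm M v = sqrt (\<integral>z. (norm (v z))\<^sup>2 \<partial>M)"

definition Linf :: "'a measure \<Rightarrow> ('a \<Rightarrow> real) set" where
  "Linf M = {v \<in> borel_measurable M. \<exists>B. AE z in M. \<bar>v z\<bar> \<le> B}"

definition nonzero :: "'a measure \<Rightarrow> ('a \<Rightarrow> 'b::euclidean_space) \<Rightarrow> bool" where
  "nonzero M v \<longleftrightarrow> \<not> (AE z in M. v z = 0)"


section \<open>Domain, boundary measure and normal\<close>

text \<open>Near each boundary point, the domain is, in suitable Cartesian coordinates, the part of a
  small rectangle that lies strictly above the graph of a Lipschitz function.\<close>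

definition lipschitz_boundary :: "plane set \<Rightarrow> bool" where
  "lipschitz_boundary \<Omega> \<longleftrightarrow> (\<forall>z\<in>frontier \<Omega>.
     \<exists>(T :: plane \<Rightarrow> plane) (G :: real \<Rightarrow> real) L a b.
       orthogonal_transformation T \<and> L-lipschitz_on UNIV G \<and> a > 0 \<and> b > 0 \<and>
       (\<forall>s y. \<bar>s\<bar> < a \<and> \<bar>y\<bar> < b \<longrightarrow> (z + T (s, y) \<in> \<Omega> \<longleftrightarrow> G s < y)))"

text \<open>One-dimensional Hausdorff measure, which is arc length on a Lipschitz curve. It is a measure
  on the Borel sets; it is completed since normals and traces are only determined up to
  null sets.\<close>

definition hausdorff1 :: "plane set \<Rightarrow> ennreal" where
  "hausdorff1 A = (SUP \<delta>\<in>{0<..}.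
     INF U\<in>{U :: nat \<Rightarrow> plane set. A \<subseteq> (\<Union>i. U i) \<and> (\<forall>i. bounded (U i) \<and> diameter (U i) \<le> \<delta>)}.
       (\<Sum>i. ennreal (diameter (U i))))"

definition arc_length :: "plane measure" where
  "arc_length = completion (measure_of UNIV (sets borel) hausdorff1)"

definition arc_length_on :: "plane set \<Rightarrow> plane measure" where
  "arc_length_on S = restrict_space arc_length S"

text \<open>A unit vector \<open>\<nu>\<close> is the outward normal at \<open>z\<close> if, near \<open>z\<close>, every cone around \<open>- \<nu>\<close> that is
  narrower than a half-plane lies in \<open>\<Omega>\<close>, and every such cone around \<open>\<nu>\<close> lies outside. Such a
  vector is unique and, for a Lipschitz boundary, exists at every point at which the boundary is
  differentiable, hence almost everywhere.\<close>

definition is_outward_normal :: "plane set \<Rightarrow> plane \<Rightarrow> plane \<Rightarrow> bool" where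
  "is_outward_normal \<Omega> z \<nu> \<longleftrightarrow> norm \<nu> = 1 \<and>
     (\<forall>\<epsilon>>0. \<exists>\<delta>>0. \<forall>y. 0 < dist y z \<and> dist y z < \<delta> \<longrightarrow>
        ((y - z) \<bullet> \<nu> < - \<epsilon> * dist y z \<longrightarrow> y \<in> \<Omega>) \<and>
        ((y - z) \<bullet> \<nu> > \<epsilon> * dist y z \<longrightarrow> y \<notin> \<Omega>))"

definition outward_normal :: "plane set \<Rightarrow> plane \<Rightarrow> plane" where
  "outward_normal \<Omega> z = (THE \<nu>. is_outward_normal \<Omega> z \<nu>)"


section \<open>Sobolev spaces\<close>

definition classical_grad :: "(plane \<Rightarrow> real) \<Rightarrow> plane \<Rightarrow> plane" where
  "classical_grad \<phi> z =
     (frechet_derivative \<phi> (at z) (1, 0), frechet_derivative \<phi> (at z) (0, 1))"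

primrec Ck :: "nat \<Rightarrow> (plane \<Rightarrow> real) \<Rightarrow> bool" where
  "Ck 0 \<phi> \<longleftrightarrow> continuous_on UNIV \<phi>"
| "Ck (Suc k) \<phi> \<longleftrightarrow> (\<forall>z. \<phi> differentiable (at z)) \<and>
     Ck k (\<lambda>z. fst (classical_grad \<phi> z)) \<and> Ck k (\<lambda>z. snd (classical_grad \<phi> z))"

definition smooth :: "(plane \<Rightarrow> real) \<Rightarrow> bool" where
  "smooth \<phi> \<longleftrightarrow> (\<forall>k. Ck k \<phi>)"

definition test_function :: "plane set \<Rightarrow> (plane \<Rightarrow> real) \<Rightarrow> bool" where
  "test_function \<Omega> \<phi> \<longleftrightarrow> smooth \<phi> \<and> (\<exists>K. compact K \<and> K \<subseteq> \<Omega> \<and> (\<forall>z. z \<notin> K \<longrightarrow> \<phi> z = 0))"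

definition is_weak_grad :: "plane set \<Rightarrow> (plane \<Rightarrow> real) \<Rightarrow> (plane \<Rightarrow> plane) \<Rightarrow> bool" where
  "is_weak_grad \<Omega> v G \<longleftrightarrow> G \<in> L2 (lebesgue_on \<Omega>) \<and>
     (\<forall>\<phi>. test_function \<Omega> \<phi> \<longrightarrow>
        (\<integral>z. v z *\<^sub>R classical_grad \<phi> z \<partial>lebesgue_on \<Omega>)
          = - (\<integral>z. \<phi> z *\<^sub>R G z \<partial>lebesgue_on \<Omega>))"

definition H1 :: "plane set \<Rightarrow> (plane \<Rightarrow> real) set" where
  "H1 \<Omega> = {v \<in> L2 (lebesgue_on \<Omega>). \<exists>G. is_weak_grad \<Omega> v G}"

text \<open>The weak gradient is determined up to a null set.\<close>

definition grad :: "plane set \<Rightarrow> (plane \<Rightarrow> real) \<Rightarrow> plane \<Rightarrow> plane" where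
  "grad \<Omega> v = (SOME G. is_weak_grad \<Omega> v G)"

definition grad_perp :: "plane set \<Rightarrow> (plane \<Rightarrow> real) \<Rightarrow> plane \<Rightarrow> plane" where
  "grad_perp \<Omega> v z = (snd (grad \<Omega> v z), - fst (grad \<Omega> v z))"

text \<open>The trace on the boundary is the continuous extension of the restriction map from functions
  smooth up to the boundary (restrictions of smooth functions on the plane), which are dense in
  \<open>H1\<close> for Lipschitz domains. It is determined up to a null set.\<close>

definition has_trace :: "plane set \<Rightarrow> (plane \<Rightarrow> real) \<Rightarrow> (plane \<Rightarrow> real) \<Rightarrow> bool" where
  "has_trace \<Omega> v \<tau> \<longleftrightarrow> v \<in> H1 \<Omega> \<and> \<tau> \<in> L2 (arc_length_on (frontier \<Omega>)) \<and>
     (\<exists>\<phi> :: nat \<Rightarrow> plane \<Rightarrow> real.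
        (\<forall>n. smooth (\<phi> n) \<and> \<phi> n \<in> L2 (arc_length_on (frontier \<Omega>))) \<and>
        (\<lambda>n. L2_norm (lebesgue_on \<Omega>) (\<lambda>z. \<phi> n z - v z)) \<longlonglongrightarrow> 0 \<and>
        (\<lambda>n. L2_norm (lebesgue_on \<Omega>) (\<lambda>z. classical_grad (\<phi> n) z - grad \<Omega> v z)) \<longlonglongrightarrow> 0 \<and>
        (\<lambda>n. L2_norm (arc_length_on (frontier \<Omega>)) (\<lambda>z. \<phi> n z - \<tau> z)) \<longlonglongrightarrow> 0)"

definition trace :: "plane set \<Rightarrow> (plane \<Rightarrow> real) \<Rightarrow> plane \<Rightarrow> real" where
  "trace \<Omega> v = (SOME \<tau>. has_trace \<Omega> v \<tau>)"

definition H1_0 :: "plane set \<Rightarrow> plane set \<Rightarrow> (plane \<Rightarrow> real) set" where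
  "H1_0 \<Omega> \<Gamma> = {\<phi> \<in> H1 \<Omega>. \<exists>\<tau>. has_trace \<Omega> \<phi> \<tau> \<and> (AE z in arc_length_on \<Gamma>. \<tau> z = 0)}"

text \<open>Finite-dimensional linear subspaces of a function space \<open>X\<close>, closed under almost everywhere
  equality within \<open>X\<close>, so that inclusion of such sets is inclusion of the subspaces.\<close>

definition findim_subspace ::
    "plane set \<Rightarrow> (plane \<Rightarrow> real) set \<Rightarrow> (plane \<Rightarrow> real) set \<Rightarrow> bool" where
  "findim_subspace \<Omega> X V \<longleftrightarrow> (\<exists>B. finite B \<and> B \<subseteq> X \<and>
     V = {v \<in> X. \<exists>c. AE z in lebesgue_on \<Omega>. v z = (\<Sum>b\<in>B. c b * b z)})"


section \<open>Dual norm, duality divergence, Helmholtz decomposition\<close>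

definition dual_norm :: "plane set \<Rightarrow> plane set \<Rightarrow> ((plane \<Rightarrow> real) \<Rightarrow> real) \<Rightarrow> ennreal" where
  "dual_norm \<Omega> \<Gamma> F = (SUP \<phi>\<in>{\<phi> \<in> H1_0 \<Omega> \<Gamma>. nonzero (lebesgue_on \<Omega>) \<phi>}.
     ennreal (\<bar>F \<phi>\<bar> / L2_norm (lebesgue_on \<Omega>) (grad \<Omega> \<phi>)))"

definition dual_div :: "plane set \<Rightarrow> (plane \<Rightarrow> plane) \<Rightarrow> (plane \<Rightarrow> real) \<Rightarrow> real" where
  "dual_div \<Omega> v \<phi> = - L2_inner (lebesgue_on \<Omega>) v (grad \<Omega> \<phi>)"

definition helmholtz :: "plane set \<Rightarrow> plane set \<Rightarrow> plane set \<Rightarrow> (plane \<Rightarrow> plane)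
    \<Rightarrow> (plane \<Rightarrow> real) \<Rightarrow> (plane \<Rightarrow> real) \<Rightarrow> bool" where
  "helmholtz \<Omega> \<Gamma>I \<Gamma>C v q \<psi> \<longleftrightarrow>
     v \<in> L2 (lebesgue_on \<Omega>) \<and> q \<in> H1_0 \<Omega> \<Gamma>C \<and> \<psi> \<in> H1_0 \<Omega> \<Gamma>I \<and>
     (AE z in lebesgue_on \<Omega>. v z = grad \<Omega> q z + grad_perp \<Omega> \<psi> z) \<and>
     L2_inner (lebesgue_on \<Omega>) (grad \<Omega> q) (grad_perp \<Omega> \<psi>) = 0 \<and>
     (\<forall>\<phi>\<in>H1_0 \<Omega> \<Gamma>C. L2_inner (lebesgue_on \<Omega>) (grad \<Omega> q) (grad \<Omega> \<phi>)
        = L2_inner (lebesgue_on \<Omega>) v (grad \<Omega> \<phi>)) \<and>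
     (\<forall>\<nu>\<in>H1_0 \<Omega> \<Gamma>I. L2_inner (lebesgue_on \<Omega>) (grad_perp \<Omega> \<psi>) (grad_perp \<Omega> \<nu>)
        = L2_inner (lebesgue_on \<Omega>) v (grad_perp \<Omega> \<nu>))"


section \<open>The balance law and the least-squares functionals\<close>

definition locally_lipschitz :: "(real \<Rightarrow> plane) \<Rightarrow> bool" where
  "locally_lipschitz f \<longleftrightarrow> (\<forall>J. compact J \<longrightarrow> (\<exists>K>0. \<forall>a\<in>J. \<forall>b\<in>J.
     \<bar>fst (f a) - fst (f b)\<bar> \<le> K * \<bar>a - b\<bar> \<and> \<bar>snd (f a) - snd (f b)\<bar> \<le> K * \<bar>a - b\<bar>))"

definition data_functional :: "plane set \<Rightarrow> plane set \<Rightarrow> (real \<Rightarrow> plane) \<Rightarrow> (plane \<Rightarrow> real)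
    \<Rightarrow> (plane \<Rightarrow> real) \<Rightarrow> (plane \<Rightarrow> real) \<Rightarrow> real" where
  "data_functional \<Omega> \<Gamma>I f r g \<phi> = L2_inner (lebesgue_on \<Omega>) r \<phi>
     - (\<integral>z. (f (g z) \<bullet> outward_normal \<Omega> z) * trace \<Omega> \<phi> z \<partial>arc_length_on \<Gamma>I)"

definition weak_solution :: "plane set \<Rightarrow> plane set \<Rightarrow> plane set \<Rightarrow> (real \<Rightarrow> plane)
    \<Rightarrow> (plane \<Rightarrow> real) \<Rightarrow> (plane \<Rightarrow> real) \<Rightarrow> (plane \<Rightarrow> real) \<Rightarrow> bool" where
  "weak_solution \<Omega> \<Gamma>I \<Gamma>C f r g v \<longleftrightarrow> v \<in> Linf (lebesgue_on \<Omega>) \<and>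
     (\<forall>\<phi>\<in>H1_0 \<Omega> \<Gamma>C.
        - L2_inner (lebesgue_on \<Omega>) (f \<circ> v) (grad \<Omega> \<phi>) = data_functional \<Omega> \<Gamma>I f r g \<phi>)"

definition LSF :: "plane set \<Rightarrow> (real \<Rightarrow> plane) \<Rightarrow> (plane \<Rightarrow> real) \<Rightarrow> (plane \<Rightarrow> real)
    \<Rightarrow> (plane \<Rightarrow> real) \<Rightarrow> (plane \<Rightarrow> real) \<Rightarrow> real" where
  "LSF \<Omega> f q v p \<mu> =
     (L2_norm (lebesgue_on \<Omega>) (\<lambda>z. f (v z) - grad \<Omega> p z - grad_perp \<Omega> \<mu> z))\<^sup>2
     + (L2_norm (lebesgue_on \<Omega>) (\<lambda>z. grad \<Omega> p z - grad \<Omega> q z))\<^sup>2"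

text \<open>In the next two definitions the infimum is attained, since the subspaces \<open>VC\<close>, \<open>VI\<close>, \<open>V\<close>
  are finite-dimensional.\<close>

definition LSG :: "plane set \<Rightarrow> (real \<Rightarrow> plane) \<Rightarrow> (plane \<Rightarrow> real) \<Rightarrow> (plane \<Rightarrow> real) set
    \<Rightarrow> (plane \<Rightarrow> real) set \<Rightarrow> (plane \<Rightarrow> real) \<Rightarrow> real" where
  "LSG \<Omega> f q VC VI v = (INF (p, \<mu>)\<in>VC \<times> VI. LSF \<Omega> f q v p \<mu>)"

definition best_err :: "plane set \<Rightarrow> (plane \<Rightarrow> real) set \<Rightarrow> (plane \<Rightarrow> real) \<Rightarrow> real" where
  "best_err \<Omega> V \<psi> = (INF \<mu>\<in>V. L2_norm (lebesgue_on \<Omega>) (grad_perp \<Omega> (\<lambda>z. \<mu> z - \<psi> z)))"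

definition flux_span :: "(real \<Rightarrow> plane) \<Rightarrow> (plane \<Rightarrow> real) set \<Rightarrow> (plane \<Rightarrow> plane) set" where
  "flux_span f U = {s. \<exists>(n::nat) c v. (\<forall>i<n. v i \<in> U) \<and> s = (\<lambda>z. \<Sum>i<n. c i *\<^sub>R f (v i z))}"

definition restricted_flux_span :: "plane set \<Rightarrow> plane set \<Rightarrow> plane set \<Rightarrow> (real \<Rightarrow> plane)
    \<Rightarrow> (plane \<Rightarrow> real) set \<Rightarrow> (plane \<Rightarrow> real) set \<Rightarrow> real \<Rightarrow> (plane \<Rightarrow> plane) set" where
  "restricted_flux_span \<Omega> \<Gamma>I \<Gamma>C f U VI \<rho> =
     {s \<in> flux_span f U. \<exists>q \<psi>. helmholtz \<Omega> \<Gamma>I \<Gamma>C s q \<psi> \<and> best_err \<Omega> VI \<psi> \<le> \<rho>}"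

definition mesh :: "real \<Rightarrow> real set" where
  "mesh h0 = range (\<lambda>k::nat. h0 / 2 ^ k)"

end

theory Submission
  imports Defs "HOL-Computational_Algebra.Polynomial"
begin

text \<open>The increment \<open>s = f(u\<^sup>h) - f(u\<^sup>2\<^sup>h)\<close> lies in the restricted flux span at level \<open>h\<close>: nestedness
  puts it into the span, and its stream function is \<open>\<psi>\<^sub>h - \<psi>\<^sub>2\<^sub>h\<close>, whose best approximation error is
  at most \<open>R\<^sub>h + R\<^sub>2\<^sub>h \<le> 2 R\<^sub>2\<^sub>h\<close>. In the pairing with gradients the data functional cancels, so the
  residual bounds and the inf-sup condition give \<open>\<parallel>s\<parallel> \<le> D h powr (\<kappa> - \<gamma>)\<close>. The increments therefore decay
  geometrically along the meshes, and the limit exists by completeness of \<open>L2\<close>. That the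
  difference of two Helmholtz decompositions is again one rests on the uniqueness of weak
  gradients, that is, on the fundamental lemma of the calculus of variations.\<close>

subsection \<open>Square-integrable functions\<close>

text \<open>The residual of a discrete solution controls only the gradient component of its flux:
  pairing with \<open>grad \<Omega> p\<close> annihilates the rotational part. The full
  \<open>L2\<close> norm of an increment has to be recovered from the inf-sup condition, at the
  price of a factor of order h to the power -\<gamma>. As \<kappa> > \<gamma>, the resulting bound
  still shrinks by the fixed factor 2 powr (\<gamma> - \<kappa>) under each halving of
  \<open>h\<close>. Two consecutive levels are compared, rather than a discrete flux with the exact
  one, because the inf-sup condition speaks only about elements of the discrete span, and the exact
  flux need not belong to it. The limit comes from completeness alone and is not identified with the
  exact flux.\<close>

lemma L2_measurable [measurable_dest]: "v \<in> L2 M \<Longrightarrow> v \<in> borel_measurable M"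
  by (simp add: L2_def)

lemma L2_integrable_square: "v \<in> L2 M \<Longrightarrow> integrable M (\<lambda>z. (norm (v z))\<^sup>2)"
  by (simp add: L2_def)

lemma L2_integrable_inner:
  assumes "v \<in> L2 M" "w \<in> L2 M"
  shows "integrable M (\<lambda>z. v z \<bullet> w z)"
proof (rule Bochner_Integration.integrable_bound)
  show "integrable M (\<lambda>z. (norm (v z))\<^sup>2 + (norm (w z))\<^sup>2)"
    using assms by (intro Bochner_Integration.integrable_add L2_integrable_square)
  show "(\<lambda>z. v z \<bullet> w z) \<in> borel_measurable M"
    using assms by measurable
  have "norm (v z \<bullet> w z) \<le> norm ((norm (v z))\<^sup>2 + (norm (w z))\<^sup>2)" for z
  proof -
    have "\<bar>v z \<bullet> w z\<bar> \<le> norm (v z) * norm (w z)"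
      by (rule Cauchy_Schwarz_ineq2)
    also have "\<dots> \<le> (norm (v z))\<^sup>2 + (norm (w z))\<^sup>2"
      using sum_squares_bound[of "norm (v z)" "norm (w z)"]
        mult_nonneg_nonneg[OF norm_ge_zero norm_ge_zero, of "v z" "w z"]
      by linarith
    finally show ?thesis by simp
  qed
  then show "AE z in M. norm (v z \<bullet> w z) \<le> norm ((norm (v z))\<^sup>2 + (norm (w z))\<^sup>2)"
    by simp
qed

lemma L2_scaleR: "v \<in> L2 M \<Longrightarrow> (\<lambda>z. c *\<^sub>R v z) \<in> L2 M"
  by (auto simp: L2_def power_mult_distrib)

lemma L2_add:
  assumes "v \<in> L2 M" "w \<in> L2 M"
  shows "(\<lambda>z. v z + w z) \<in> L2 M"
proof -
  have "(norm (v z + w z))\<^sup>2 = (norm (v z))\<^sup>2 + 2 * (v z \<bullet> w z) + (norm (w z))\<^sup>2" for z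
    by (simp add: power2_norm_eq_inner inner_simps inner_commute)
  moreover have "integrable M (\<lambda>z. (norm (v z))\<^sup>2 + 2 * (v z \<bullet> w z) + (norm (w z))\<^sup>2)"
    using assms by (intro Bochner_Integration.integrable_add integrable_mult_right
        L2_integrable_square L2_integrable_inner)
  moreover have "(\<lambda>z. v z + w z) \<in> borel_measurable M"
    using assms by measurable
  ultimately show ?thesis
    by (simp add: L2_def)
qed

lemma L2_diff:
  assumes "v \<in> L2 M" "w \<in> L2 M"
  shows "(\<lambda>z. v z - w z) \<in> L2 M"
  using L2_add[OF assms(1) L2_scaleR[OF assms(2), of "-1"]] by simp

lemma L2_norm_nonneg [simp]: "0 \<le> L2_norm M v"
  by (simp add: L2_norm_def)

lemma L2_norm_square: "(L2_norm M v)\<^sup>2 = L2_inner M v v"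
  by (simp add: L2_norm_def L2_inner_def power2_norm_eq_inner)

lemma L2_norm_minus_commute: "L2_norm M (\<lambda>z. v z - w z) = L2_norm M (\<lambda>z. w z - v z)"
  by (simp add: L2_norm_def norm_minus_commute)

lemma L2_norm_cong_AE:
  assumes "AE z in M. v z = w z" "v \<in> borel_measurable M" "w \<in> borel_measurable M"
  shows "L2_norm M v = L2_norm M w"
  unfolding L2_norm_def
  by (rule arg_cong[where f = sqrt], rule integral_cong_AE) (use assms in auto)

lemma L2_inner_cong_AE:
  assumes "AE z in M. v z = w z" "v \<in> L2 M" "w \<in> L2 M" "x \<in> L2 M"
  shows "L2_inner M v x = L2_inner M w x"
  unfolding L2_inner_def
  by (rule integral_cong_AE) (use assms in \<open>auto intro: L2_measurable\<close>)

lemma L2_inner_commute: "L2_inner M v w = L2_inner M w v"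
  by (simp add: L2_inner_def inner_commute)

lemma L2_inner_add_left:
  assumes "v \<in> L2 M" "w \<in> L2 M" "x \<in> L2 M"
  shows "L2_inner M (\<lambda>z. v z + w z) x = L2_inner M v x + L2_inner M w x"
  using assms by (simp add: L2_inner_def inner_add_left L2_integrable_inner)

lemma L2_inner_diff_left:
  assumes "v \<in> L2 M" "w \<in> L2 M" "x \<in> L2 M"
  shows "L2_inner M (\<lambda>z. v z - w z) x = L2_inner M v x - L2_inner M w x"
  using assms by (simp add: L2_inner_def inner_diff_left L2_integrable_inner)

lemma L2_inner_diff_right:
  assumes "v \<in> L2 M" "w \<in> L2 M" "x \<in> L2 M"
  shows "L2_inner M x (\<lambda>z. v z - w z) = L2_inner M x v - L2_inner M x w"
  using L2_inner_diff_left[OF assms] by (simp add: L2_inner_commute)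

lemma L2_norm_zero_iff:
  assumes "v \<in> L2 M"
  shows "L2_norm M v = 0 \<longleftrightarrow> (AE z in M. v z = 0)"
  using integral_nonneg_eq_0_iff_AE[OF L2_integrable_square[OF assms]]
  by (simp add: L2_norm_def)

lemma L2_Cauchy_Schwarz:
  assumes v: "v \<in> L2 M" and w: "w \<in> L2 M"
  shows "\<bar>L2_inner M v w\<bar> \<le> L2_norm M v * L2_norm M w"
proof (cases "L2_norm M w = 0")
  case True
  then have "AE z in M. w z = 0"
    using L2_norm_zero_iff[OF w] by simp
  then have "AE z in M. v z \<bullet> w z = 0"
    by eventually_elim simp
  then have "L2_inner M v w = 0"
    unfolding L2_inner_def by (rule integral_eq_zero_AE)
  then show ?thesis by simp
next
  case False
  define B where "B = L2_inner M v w"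
  define D where "D = L2_inner M w w"
  have D: "D > 0"
    using False L2_norm_square[of M w] by (metis D_def zero_less_power2)
  \<comment> \<open>This \<open>t\<close> minimises the norm of \<open>v - t w\<close>;
    nonnegativity of the minimal value is the inequality.\<close>
  define t where "t = B / D"
  have tw: "(\<lambda>z. t *\<^sub>R w z) \<in> L2 M"
    by (rule L2_scaleR[OF w])
  have sc: "L2_inner M (\<lambda>z. t *\<^sub>R w z) x = t * L2_inner M w x" for x
    by (simp add: L2_inner_def)
  have "0 \<le> L2_inner M (\<lambda>z. v z - t *\<^sub>R w z) (\<lambda>z. v z - t *\<^sub>R w z)"
    by (metis L2_norm_square zero_le_power2)
  also have "\<dots> = L2_inner M v v - 2 * t * B + t * t * D"
    using v w tw by (simp add: L2_inner_diff_left L2_inner_diff_right L2_diff sc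
        L2_inner_commute[of M _ "\<lambda>z. t *\<^sub>R w z"] L2_inner_commute[of M w v] B_def D_def algebra_simps)
  also have "\<dots> = L2_inner M v v - B\<^sup>2 / D"
    using D by (simp add: t_def power2_eq_square)
  finally have "B\<^sup>2 \<le> L2_inner M v v * D"
    using D by (simp add: field_simps)
  also have "\<dots> = (L2_norm M v * L2_norm M w)\<^sup>2"
    by (simp add: power_mult_distrib L2_norm_square D_def)
  finally show ?thesis
    unfolding B_def by (simp add: abs_le_square_iff[symmetric] abs_mult)
qed

lemma L2_norm_add_le:
  assumes "v \<in> L2 M" "w \<in> L2 M"
  shows "L2_norm M (\<lambda>z. v z + w z) \<le> L2_norm M v + L2_norm M w"
proof (rule power2_le_imp_le)
  have inner: "L2_inner M (\<lambda>z. v z + w z) x = L2_inner M v x + L2_inner M w x" if "x \<in> L2 M" for x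
    by (rule L2_inner_add_left[OF assms that])
  have "L2_inner M (\<lambda>z. v z + w z) (\<lambda>z. v z + w z)
      = L2_inner M (\<lambda>z. v z + w z) v + L2_inner M (\<lambda>z. v z + w z) w"
    by (simp only: inner L2_add assms L2_inner_commute[of M v "\<lambda>z. v z + w z"]
        L2_inner_commute[of M w "\<lambda>z. v z + w z"])
  also have "\<dots> = L2_inner M v v + 2 * L2_inner M v w + L2_inner M w w"
    using assms by (simp add: inner L2_inner_commute[of M w v])
  finally have "(L2_norm M (\<lambda>z. v z + w z))\<^sup>2
      = (L2_norm M v)\<^sup>2 + 2 * L2_inner M v w + (L2_norm M w)\<^sup>2"
    by (simp add: L2_norm_square)
  then show "(L2_norm M (\<lambda>z. v z + w z))\<^sup>2 \<le> (L2_norm M v + L2_norm M w)\<^sup>2"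
    using L2_Cauchy_Schwarz[OF assms] by (simp add: power2_sum)
qed simp

lemma L2_norm_minus: "L2_norm M (\<lambda>z. - v z) = L2_norm M v"
  by (simp add: L2_norm_def)

lemma L2_norm_diff_le:
  assumes "v \<in> L2 M" "w \<in> L2 M"
  shows "L2_norm M (\<lambda>z. v z - w z) \<le> L2_norm M v + L2_norm M w"
  using L2_norm_add_le[OF assms(1) L2_scaleR[OF assms(2), of "-1"]] by (simp add: L2_norm_minus)

section \<open>Completeness of \<open>L2\<close> for geometrically decaying increments\<close>

lemma nn_integral_L2_norm:
  assumes "v \<in> L2 M"
  shows "(\<integral>\<^sup>+z. ennreal ((norm (v z))\<^sup>2) \<partial>M) = ennreal ((L2_norm M v)\<^sup>2)"
  using nn_integral_eq_integral[OF L2_integrable_square[OF assms]] by (simp add: L2_norm_def)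

text \<open>Fatou's lemma yields a bound on a nonnegative integral before square integrability of
  the limit is known; this turns such a bound into membership and a norm estimate at once.\<close>

lemma L2_if_nn_integral_le:
  assumes v: "v \<in> borel_measurable M" and "0 \<le> B"
    and le: "(\<integral>\<^sup>+z. ennreal ((norm (v z))\<^sup>2) \<partial>M) \<le> ennreal (B\<^sup>2)"
  shows "v \<in> L2 M" "L2_norm M v \<le> B"
proof -
  show 1: "v \<in> L2 M"
    using v le unfolding L2_def integrable_iff_bounded
    by (auto intro: le_less_trans)
  have "(L2_norm M v)\<^sup>2 \<le> B\<^sup>2"
    using le nn_integral_L2_norm[OF 1] by simp
  then show "L2_norm M v \<le> B"
    using \<open>0 \<le> B\<close> power2_le_imp_le by blast
qed

lemma L2_norm_telescope:
  assumes v: "\<And>k. v k \<in> L2 M"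
    and step: "\<And>k. L2_norm M (\<lambda>z. v (Suc k) z - v k z) \<le> A * \<rho> ^ k"
    and A: "0 \<le> A" and \<rho>: "0 < \<rho>" "\<rho> < 1" and "k \<le> m"
  shows "L2_norm M (\<lambda>z. v m z - v k z) \<le> A * \<rho> ^ k / (1 - \<rho>)"
proof -
  \<comment> \<open>The claimed bound is independent of \<open>m\<close> and would not pass through
    the induction. The partial geometric sum does, and discarding \<rho> ^ m afterwards gives the
    claim.\<close>
  have "L2_norm M (\<lambda>z. v m z - v k z) \<le> A * (\<rho> ^ k - \<rho> ^ m) / (1 - \<rho>)"
    using \<open>k \<le> m\<close>
  proof (induction m rule: dec_induct)
    case base
    then show ?case by (simp add: L2_norm_def)
  next
    case (step n)
    have "L2_norm M (\<lambda>z. v (Suc n) z - v k z)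
        = L2_norm M (\<lambda>z. (v (Suc n) z - v n z) + (v n z - v k z))"
      by simp
    also have "\<dots> \<le> L2_norm M (\<lambda>z. v (Suc n) z - v n z) + L2_norm M (\<lambda>z. v n z - v k z)"
      by (intro L2_norm_add_le L2_diff v)
    also have "\<dots> \<le> A * \<rho> ^ n + A * (\<rho> ^ k - \<rho> ^ n) / (1 - \<rho>)"
      using assms(2)[of n] step.IH by linarith
    also have "\<dots> = A * (\<rho> ^ k - \<rho> ^ Suc n) / (1 - \<rho>)"
      using \<rho> by (simp add: field_simps)
    finally show ?case .
  qed
  also have "\<dots> \<le> A * \<rho> ^ k / (1 - \<rho>)"
    using A \<rho> by (intro divide_right_mono mult_left_mono) auto
  finally show ?thesis .
qed

text \<open>Pointwise convergence comes from \<open>\<Sum>k. \<rho>\<^sup>-\<^sup>k |v\<^sub>k\<^sub>+\<^sub>1 - v\<^sub>k|\<^sup>2 < \<infinity>\<close> almost everywhere, since the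
  weights make the increments summable; Fatou's lemma then gives the estimate.\<close>

lemma L2_geometric_limit:
  fixes v :: "nat \<Rightarrow> 'a \<Rightarrow> 'b::euclidean_space"
  assumes v: "\<And>k. v k \<in> L2 M"
    and step: "\<And>k. L2_norm M (\<lambda>z. v (Suc k) z - v k z) \<le> A * \<rho> ^ k"
    and A: "0 \<le> A" and \<rho>: "0 < \<rho>" "\<rho> < 1"
  shows "\<exists>w\<in>L2 M. \<forall>k. L2_norm M (\<lambda>z. v k z - w z) \<le> A * \<rho> ^ k / (1 - \<rho>)"
proof -
  define d where "d k z = v (Suc k) z - v k z" for k z
  have d: "d k \<in> L2 M" for k
    unfolding d_def by (intro L2_diff v)
  define e where "e k z = (norm (d k z))\<^sup>2 / \<rho> ^ k" for k z
  have e_meas [measurable]: "e k \<in> borel_measurable M" for k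
    using d[of k] unfolding e_def by measurable
  have e_nonneg: "0 \<le> e k z" for k z
    using \<rho> by (simp add: e_def)
  have e_int: "(\<integral>\<^sup>+z. ennreal (e k z) \<partial>M) \<le> ennreal (A\<^sup>2 * \<rho> ^ k)" for k
  proof -
    have "(\<integral>\<^sup>+z. ennreal (e k z) \<partial>M) = (\<integral>\<^sup>+z. ennreal (1 / \<rho> ^ k) * ennreal ((norm (d k z))\<^sup>2) \<partial>M)"
      using \<rho> by (intro nn_integral_cong) (simp add: e_def ennreal_mult[symmetric])
    also have "\<dots> = ennreal (1 / \<rho> ^ k) * ennreal ((L2_norm M (d k))\<^sup>2)"
      using d[of k] by (subst nn_integral_cmult) (auto simp: nn_integral_L2_norm)
    also have "\<dots> = ennreal ((L2_norm M (d k))\<^sup>2 / \<rho> ^ k)"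
      using \<rho> by (simp add: ennreal_mult[symmetric])
    also have "\<dots> \<le> ennreal ((A * \<rho> ^ k)\<^sup>2 / \<rho> ^ k)"
      using \<rho> step[of k] by (intro ennreal_leI divide_right_mono power_mono) (auto simp: d_def[abs_def])
    also have "(A * \<rho> ^ k)\<^sup>2 / \<rho> ^ k = A\<^sup>2 * \<rho> ^ k"
      using \<rho> by (simp add: power2_eq_square)
    finally show ?thesis .
  qed
  have "(\<integral>\<^sup>+z. (\<Sum>k. ennreal (e k z)) \<partial>M) = (\<Sum>k. \<integral>\<^sup>+z. ennreal (e k z) \<partial>M)"
    by (intro nn_integral_suminf) measurable
  also have "\<dots> \<le> (\<Sum>k. ennreal (A\<^sup>2 * \<rho> ^ k))"
    by (intro suminf_le e_int) auto
  also have "\<dots> = ennreal (\<Sum>k. A\<^sup>2 * \<rho> ^ k)"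
    using \<rho> by (intro suminf_ennreal2) (auto intro!: summable_mult summable_geometric)
  also have "\<dots> < \<infinity>" by simp
  finally have "AE z in M. (\<Sum>k. ennreal (e k z)) \<noteq> \<infinity>"
    by (intro nn_integral_PInf_AE) auto
  then have conv: "AE z in M. convergent (\<lambda>k. v k z)"
  proof eventually_elim
    case (elim z)
    then have "summable (\<lambda>k. e k z)"
      by (intro summable_suminf_not_top e_nonneg) auto
    \<comment> \<open>Summability of the weighted squares is used only through their boundedness: it
      dominates the increments by a geometric series of ratio sqrt \<rho>.\<close>
    then have "Bseq (\<lambda>k. e k z)"
      using summable_LIMSEQ_zero convergentI convergent_imp_Bseq by blast
    then obtain B where B: "B > 0" "\<And>k. e k z \<le> B"
      using e_nonneg[of _ z] by (auto elim!: BseqE)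
    have "norm (d k z) \<le> sqrt B * (sqrt \<rho>) ^ k" for k
    proof -
      have "(norm (d k z))\<^sup>2 \<le> B * \<rho> ^ k"
        using B(2)[of k] \<rho> by (simp add: e_def field_simps)
      then have "norm (d k z) \<le> sqrt (B * \<rho> ^ k)"
        by (simp add: real_le_rsqrt)
      then show ?thesis
        by (simp add: real_sqrt_mult real_sqrt_power)
    qed
    moreover have "summable (\<lambda>k. sqrt B * (sqrt \<rho>) ^ k)"
      using \<rho> by (intro summable_mult summable_geometric) auto
    ultimately have "summable (\<lambda>k. d k z)"
      by (intro summable_comparison_test[of "\<lambda>k. d k z" "\<lambda>k. sqrt B * (sqrt \<rho>) ^ k"]) blast+
    then have "convergent (\<lambda>n. \<Sum>k<n. d k z)"
      by (simp add: summable_iff_convergent)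
    then have "convergent (\<lambda>n. v n z - v 0 z)"
      by (simp add: d_def sum_lessThan_telescope[of "\<lambda>n. v n z"])
    then have "convergent (\<lambda>n. (v n z - v 0 z) + v 0 z)"
      by (intro convergent_add convergent_const)
    then show ?case by simp
  qed
  \<comment> \<open>Where the sequence diverges, \<open>lim\<close> returns one fixed unspecified
    value, so \<open>w\<close> is total and measurable; convergence to it is claimed only almost
    everywhere.\<close>
  define w where "w z = lim (\<lambda>k. v k z)" for z
  have v_meas [measurable]: "v k \<in> borel_measurable M" for k
    using v by (rule L2_measurable)
  have w_meas [measurable]: "w \<in> borel_measurable M"
    unfolding w_def by measurable
  have lim: "AE z in M. (\<lambda>k. v k z) \<longlonglongrightarrow> w z"
    using conv by eventually_elim (simp add: w_def convergent_LIMSEQ_iff)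
  have *: "(\<lambda>z. v k z - w z) \<in> L2 M \<and> L2_norm M (\<lambda>z. v k z - w z) \<le> A * \<rho> ^ k / (1 - \<rho>)" for k
  proof -
    define B where "B = A * \<rho> ^ k / (1 - \<rho>)"
    have B: "0 \<le> B"
      using A \<rho> by (simp add: B_def)
    have "(\<integral>\<^sup>+z. ennreal ((norm (v k z - w z))\<^sup>2) \<partial>M)
        = (\<integral>\<^sup>+z. liminf (\<lambda>m. ennreal ((norm (v k z - v m z))\<^sup>2)) \<partial>M)"
    proof (rule nn_integral_cong_AE)
      show "AE z in M. ennreal ((norm (v k z - w z))\<^sup>2)
          = liminf (\<lambda>m. ennreal ((norm (v k z - v m z))\<^sup>2))"
        using lim
      proof eventually_elim
        case (elim z)
        then have "(\<lambda>m. ennreal ((norm (v k z - v m z))\<^sup>2)) \<longlonglongrightarrow> ennreal ((norm (v k z - w z))\<^sup>2)"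
          by (intro tendsto_ennrealI tendsto_intros)
        then show ?case
          by (rule lim_imp_Liminf[OF trivial_limit_sequentially, symmetric])
      qed
    qed
    also have "\<dots> \<le> liminf (\<lambda>m. \<integral>\<^sup>+z. ennreal ((norm (v k z - v m z))\<^sup>2) \<partial>M)"
      by (intro nn_integral_liminf) measurable
    also have "\<dots> \<le> ennreal (B\<^sup>2)"
    proof -
      have "(\<integral>\<^sup>+z. ennreal ((norm (v k z - v m z))\<^sup>2) \<partial>M) \<le> ennreal (B\<^sup>2)" if "k \<le> m" for m
        using L2_norm_telescope[OF v step A \<rho> that]
        by (subst nn_integral_L2_norm)
          (auto intro!: L2_diff v ennreal_leI power_mono simp: B_def L2_norm_minus_commute[of M "v k"])
      then have "\<forall>\<^sub>F m in sequentially. (\<integral>\<^sup>+z. ennreal ((norm (v k z - v m z))\<^sup>2) \<partial>M) \<le> ennreal (B\<^sup>2)"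
        unfolding eventually_sequentially by blast
      then have "liminf (\<lambda>m. \<integral>\<^sup>+z. ennreal ((norm (v k z - v m z))\<^sup>2) \<partial>M)
          \<le> liminf (\<lambda>m::nat. ennreal (B\<^sup>2))"
        by (rule Liminf_mono)
      then show ?thesis
        by (simp add: Liminf_const)
    qed
    finally show ?thesis
      using L2_if_nn_integral_le[of "\<lambda>z. v k z - w z" M B] B unfolding B_def by simp
  qed
  have "w \<in> L2 M"
    using L2_diff[OF v[of 0] conjunct1[OF *[of 0]]] by simp
  then show ?thesis
    using * by blast
qed

subsection \<open>Smooth bump functions\<close>

lemma linear_plane_functional:
  fixes D :: "plane \<Rightarrow> real"
  assumes "linear D"
  shows "D h = D (1, 0) * fst h + D (0, 1) * snd h"
proof -
  have "D h = D (fst h *\<^sub>R (1, 0) + snd h *\<^sub>R (0, 1))"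
    by (cases h) simp
  also have "\<dots> = fst h * D (1, 0) + snd h * D (0, 1)"
    by (simp only: linear_add[OF assms] linear_scale[OF assms] real_scaleR_def)
  finally show ?thesis
    by (simp add: mult.commute)
qed

lemma classical_grad_eq:
  assumes "(\<phi> has_derivative D) (at z)"
  shows "classical_grad \<phi> z = (D (1, 0), D (0, 1))"
  using frechet_derivative_at[OF assms] by (simp add: classical_grad_def)

lemma has_derivative_classical_grad:
  assumes "\<phi> differentiable (at z)"
  shows "(\<phi> has_derivative (\<lambda>h. fst (classical_grad \<phi> z) * fst h + snd (classical_grad \<phi> z) * snd h)) (at z)"
proof -
  have "(\<phi> has_derivative frechet_derivative \<phi> (at z)) (at z)"
    using assms by (simp add: frechet_derivative_works)
  moreover from this have "frechet_derivative \<phi> (at z) h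
      = fst (classical_grad \<phi> z) * fst h + snd (classical_grad \<phi> z) * snd h" for h
    unfolding classical_grad_def fst_conv snd_conv
    by (intro linear_plane_functional has_derivative_linear)
  ultimately show ?thesis
    by (rule has_derivative_eq_rhs[OF _ ext])
qed

text \<open>\<open>Ck\<close> refers to the derivative chosen by \<open>frechet_derivative\<close>.
  Since derivatives are unique, any explicit pair of partials may replace it, which reduces the
  closure properties below to inductions using the \<open>has_derivative\<close> rules.\<close>

lemma Ck_SucI:
  assumes "\<And>z. (\<phi> has_derivative (\<lambda>h. a z * fst h + b z * snd h)) (at z)" "Ck k a" "Ck k b"
  shows "Ck (Suc k) \<phi>"
proof -
  have "classical_grad \<phi> z = (a z, b z)" for z
    using classical_grad_eq[OF assms(1)] by simp
  then show ?thesis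
    using assms unfolding differentiable_def Ck.simps by (metis (no_types, lifting) ext fst_conv snd_conv)
qed

lemma Ck_SucE:
  assumes "Ck (Suc k) \<phi>"
  obtains a b where "\<And>z. (\<phi> has_derivative (\<lambda>h. a z * fst h + b z * snd h)) (at z)" "Ck k a" "Ck k b"
proof
  show "(\<phi> has_derivative (\<lambda>h. fst (classical_grad \<phi> z) * fst h + snd (classical_grad \<phi> z) * snd h)) (at z)" for z
    using assms has_derivative_classical_grad[of \<phi>] unfolding Ck.simps by blast
qed (use assms in auto)

lemma Ck_const: "Ck k (\<lambda>z. c)"
proof (induction k arbitrary: c)
  case (Suc k)
  have "((\<lambda>z::plane. c) has_derivative (\<lambda>h. 0 * fst h + 0 * snd h)) (at z)" for z
    by simp
  then show ?case
    by (rule Ck_SucI) (rule Suc)+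
qed simp

lemma Ck_continuous_on: "Ck k \<phi> \<Longrightarrow> continuous_on UNIV \<phi>"
  by (cases k) (simp, metis Ck.simps(2) continuous_at_imp_continuous_on
      differentiable_imp_continuous_within)

text \<open>The product rule leaves undifferentiated factors in the partials, and the induction in
  \<open>Ck_mult\<close> needs these one order lower.\<close>

lemma Ck_SucD: "Ck (Suc k) \<phi> \<Longrightarrow> Ck k \<phi>"
proof (induction k arbitrary: \<phi>)
  case 0
  then show ?case
    unfolding Ck.simps(1) by (rule Ck_continuous_on)
next
  case (Suc k)
  then show ?case
    by (metis Ck.simps(2))
qed

lemma Ck_diff: "Ck k \<phi> \<Longrightarrow> Ck k \<eta> \<Longrightarrow> Ck k (\<lambda>z. \<phi> z - \<eta> z)"
proof (induction k arbitrary: \<phi> \<eta>)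
  case 0
  then show ?case by (auto intro: continuous_intros)
next
  case (Suc k)
  obtain a b where \<phi>: "\<And>z. (\<phi> has_derivative (\<lambda>h. a z * fst h + b z * snd h)) (at z)"
    and ab: "Ck k a" "Ck k b"
    using Suc.prems(1) by (elim Ck_SucE) blast
  obtain a' b' where \<eta>: "\<And>z. (\<eta> has_derivative (\<lambda>h. a' z * fst h + b' z * snd h)) (at z)"
    and ab': "Ck k a'" "Ck k b'"
    using Suc.prems(2) by (elim Ck_SucE) blast
  have "((\<lambda>z. \<phi> z - \<eta> z) has_derivative (\<lambda>h. (a z - a' z) * fst h + (b z - b' z) * snd h)) (at z)" for z
    by (rule has_derivative_eq_rhs[OF has_derivative_diff[OF \<phi> \<eta>]]) (auto simp: algebra_simps)
  then show ?case
    by (rule Ck_SucI) (intro Suc.IH ab ab')+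
qed

lemma Ck_add: "Ck k \<phi> \<Longrightarrow> Ck k \<eta> \<Longrightarrow> Ck k (\<lambda>z. \<phi> z + \<eta> z)"
  using Ck_diff[of k \<phi> "\<lambda>z. 0 - \<eta> z"] Ck_diff[OF Ck_const, of k \<eta> 0] by simp

lemma Ck_mult: "Ck k \<phi> \<Longrightarrow> Ck k \<eta> \<Longrightarrow> Ck k (\<lambda>z. \<phi> z * \<eta> z)"
proof (induction k arbitrary: \<phi> \<eta>)
  case 0
  then show ?case by (auto intro: continuous_intros)
next
  case (Suc k)
  obtain a b where \<phi>: "\<And>z. (\<phi> has_derivative (\<lambda>h. a z * fst h + b z * snd h)) (at z)"
    and ab: "Ck k a" "Ck k b"
    using Suc.prems(1) by (elim Ck_SucE) blast
  obtain a' b' where \<eta>: "\<And>z. (\<eta> has_derivative (\<lambda>h. a' z * fst h + b' z * snd h)) (at z)"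
    and ab': "Ck k a'" "Ck k b'"
    using Suc.prems(2) by (elim Ck_SucE) blast
  have "((\<lambda>z. \<phi> z * \<eta> z) has_derivative
      (\<lambda>h. (\<phi> z * a' z + a z * \<eta> z) * fst h + (\<phi> z * b' z + b z * \<eta> z) * snd h)) (at z)" for z
    by (rule has_derivative_eq_rhs[OF has_derivative_mult[OF \<phi> \<eta>]]) (auto simp: algebra_simps)
  moreover have "Ck k (\<lambda>z. \<phi> z * a' z + a z * \<eta> z)" "Ck k (\<lambda>z. \<phi> z * b' z + b z * \<eta> z)"
    using Suc.IH ab ab' Suc.prems[THEN Ck_SucD] by (auto intro!: Ck_add)
  ultimately show ?case
    by (rule Ck_SucI)
qed

lemma smooth_mult: "smooth \<phi> \<Longrightarrow> smooth \<eta> \<Longrightarrow> smooth (\<lambda>z. \<phi> z * \<eta> z)"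
  by (simp add: smooth_def Ck_mult)

lemma smooth_diff: "smooth \<phi> \<Longrightarrow> smooth \<eta> \<Longrightarrow> smooth (\<lambda>z. \<phi> z - \<eta> z)"
  by (simp add: smooth_def Ck_diff)

lemma smooth_differentiable: "smooth \<phi> \<Longrightarrow> \<phi> differentiable (at z)"
  unfolding smooth_def by (metis Ck.simps(2))

lemma smooth_continuous_on: "smooth \<phi> \<Longrightarrow> continuous_on S \<phi>"
  unfolding smooth_def by (metis Ck_continuous_on continuous_on_subset subset_UNIV)

lemma smooth_continuous_on_classical_grad:
  assumes "smooth \<phi>"
  shows "continuous_on S (classical_grad \<phi>)"
proof -
  have "Ck (Suc 0) \<phi>"
    using assms by (simp only: smooth_def)
  then have "continuous_on UNIV (\<lambda>z. (fst (classical_grad \<phi> z), snd (classical_grad \<phi> z)))"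
    by (intro continuous_on_Pair) auto
  then show ?thesis
    by (auto intro: continuous_on_subset)
qed

lemma classical_grad_diff:
  assumes "\<phi> differentiable (at z)" "\<eta> differentiable (at z)"
  shows "classical_grad (\<lambda>z. \<phi> z - \<eta> z) z = classical_grad \<phi> z - classical_grad \<eta> z"
  using classical_grad_eq[OF has_derivative_diff[OF has_derivative_classical_grad[OF assms(1)]
      has_derivative_classical_grad[OF assms(2)]]]
  by (simp add: prod_eq_iff)

text \<open>This family contains \<open>exp (- c / x)\<close>, extended by 0, and is closed under differentiation.\<close>

definition flat :: "real \<Rightarrow> real poly \<Rightarrow> real \<Rightarrow> real" where
  "flat c P x = (if x > 0 then poly P (1 / x) * exp (- c / x) else 0)"

text \<open>The exponential beats every polynomial. The power \<open>y ^ n\<close> is carried along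
  because \<open>pCons\<close> multiplies the remaining polynomial by \<open>y\<close>, which the
  induction hypothesis absorbs with exponent \<open>Suc n\<close>. With \<open>y = 1 / x\<close>
  this is the flatness of \<open>flat c P\<close> at 0 from the right.\<close>

lemma tendsto_power_mult_poly_mult_exp_0:
  fixes c :: real
  assumes "c > 0"
  shows "((\<lambda>y. y ^ n * poly P y * exp (- c * y)) \<longlongrightarrow> 0) at_top"
proof (induction P arbitrary: n)
  case 0
  then show ?case by simp
next
  case (pCons a P)
  have "filterlim (\<lambda>y. c * y) at_top at_top"
    using assms by (intro filterlim_tendsto_pos_mult_at_top[OF tendsto_const] filterlim_ident)
  then have "((\<lambda>y. (c * y) ^ n / exp (c * y)) \<longlongrightarrow> 0) at_top"
    by (rule filterlim_compose[OF tendsto_power_div_exp_0])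
  then have "((\<lambda>y. a / c ^ n * ((c * y) ^ n / exp (c * y)) + y ^ Suc n * poly P y * exp (- c * y))
      \<longlongrightarrow> a / c ^ n * 0 + 0) at_top"
    by (intro tendsto_add tendsto_mult tendsto_const pCons.IH)
  moreover have "a / c ^ n * ((c * y) ^ n / exp (c * y)) + y ^ Suc n * poly P y * exp (- c * y)
      = y ^ n * poly (pCons a P) y * exp (- c * y)" for y
    using assms by (simp add: power_mult_distrib exp_minus field_simps)
  ultimately show ?case
    by simp
qed

text \<open>With \<open>y = 1 / x\<close> one has dy/dx = - y^2, so differentiating P(y) exp(- c y)
  gives y^2 (c P(y) - P'(y)) exp(- c y); \<open>[:0, 0, 1:]\<close> is the polynomial y^2. At 0 the
  formula predicts the value 0, which has to be checked on the two one-sided difference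
  quotients.\<close>

lemma DERIV_flat:
  assumes c: "c > 0"
  shows "(flat c P has_real_derivative flat c ([:0, 0, 1:] * (smult c P - pderiv P)) x) (at x)"
proof (cases x "0 :: real" rule: linorder_cases)
  case less
  have "(flat c P has_real_derivative 0) (at x)"
    by (rule has_field_derivative_transform_within_open[where S = "{..<0}" and f = "\<lambda>_. 0"])
      (use less in \<open>auto simp: flat_def\<close>)
  then show ?thesis
    using less by (simp add: flat_def)
next
  case greater
  have "((\<lambda>x. poly P (1 / x) * exp (- c / x)) has_real_derivative
      flat c ([:0, 0, 1:] * (smult c P - pderiv P)) x) (at x)"
    using greater
    by (auto intro!: derivative_eq_intros simp: flat_def power2_eq_square field_simps)
  then show ?thesis
    by (rule has_field_derivative_transform_within_open[where S = "{0<..}"])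
      (use greater in \<open>auto simp: flat_def\<close>)
next
  case equal
  have "((\<lambda>h. (flat c P h - flat c P 0) / (h - 0)) \<longlongrightarrow> 0) (at 0)"
    unfolding filterlim_at_split
  proof
    have "\<forall>\<^sub>F h in at_left 0. (flat c P h - flat c P 0) / (h - 0) = 0"
      by (auto simp: eventually_at_filter flat_def)
    then show "((\<lambda>h. (flat c P h - flat c P 0) / (h - 0)) \<longlongrightarrow> 0) (at_left 0)"
      by (rule tendsto_eventually)
    \<comment> \<open>Division by \<open>h\<close> costs one power of \<open>inverse h\<close>,
      hence the exponent 1.\<close>
    have lim: "((\<lambda>h. inverse h ^ 1 * poly P (inverse h) * exp (- c * inverse h)) \<longlongrightarrow> 0) (at_right 0)"
      by (rule filterlim_compose[OF tendsto_power_mult_poly_mult_exp_0[OF c]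
            filterlim_inverse_at_top_right])
    have "\<forall>\<^sub>F h in at_right 0. inverse h ^ 1 * poly P (inverse h) * exp (- c * inverse h)
        = (flat c P h - flat c P 0) / (h - 0)"
      by (auto simp: eventually_at_filter flat_def field_simps)
    then show "((\<lambda>h. (flat c P h - flat c P 0) / (h - 0)) \<longlongrightarrow> 0) (at_right 0)"
      by (rule Lim_transform_eventually[OF lim])
  qed
  then show ?thesis
    using equal by (simp add: has_field_derivative_iff flat_def)
qed

text \<open>The chain rule contributes the factors \<alpha> and \<beta>, which \<open>smult\<close>
  moves into the polynomial. Both partials thus stay in the family, but with another polynomial, so
  the induction runs over all \<open>P\<close>.\<close>

lemma Ck_flat_affine:
  assumes "c > 0"
  shows "Ck k (\<lambda>z. flat c P (\<alpha> * fst z + \<beta> * snd z + \<delta>))"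
proof (induction k arbitrary: P)
  case 0
  have "continuous_on UNIV (flat c P)"
    using DERIV_flat[OF assms] by (meson DERIV_continuous continuous_at_imp_continuous_on)
  then show ?case
    by (auto intro!: continuous_intros continuous_on_compose2[of UNIV "flat c P"])
next
  case (Suc k)
  let ?Q = "[:0, 0, 1:] * (smult c P - pderiv P)"
  have smult: "flat c (smult a Q) x = a * flat c Q x" for a Q x
    by (simp add: flat_def)
  have "((\<lambda>z. flat c P (\<alpha> * fst z + \<beta> * snd z + \<delta>)) has_derivative
      (\<lambda>h. flat c (smult \<alpha> ?Q) (\<alpha> * fst z + \<beta> * snd z + \<delta>) * fst h
         + flat c (smult \<beta> ?Q) (\<alpha> * fst z + \<beta> * snd z + \<delta>) * snd h)) (at z)" for z
    unfolding smult
    by (rule has_derivative_eq_rhs[OF has_derivative_compose[OF _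
            DERIV_flat[OF assms, unfolded has_field_derivative_def]]])
      (auto intro!: derivative_eq_intros simp: algebra_simps)
  then show ?case
    by (rule Ck_SucI) (rule Suc)+
qed

text \<open>One factor exp (- c / x) for each side of the box, where x is the signed distance to
  that side; the product is positive exactly on the open box. The parameter \<open>c\<close> governs
  steepness and not support: as it tends to 0, the bumps fill up the box.\<close>

definition bump :: "real \<Rightarrow> plane \<Rightarrow> plane \<Rightarrow> plane \<Rightarrow> real" where
  "bump c a b z = flat c 1 (fst z - fst a) * flat c 1 (fst b - fst z)
     * (flat c 1 (snd z - snd a) * flat c 1 (snd b - snd z))"

lemma smooth_bump:
  assumes "c > 0"
  shows "smooth (bump c a b)"
proof -
  have "smooth (\<lambda>z. flat c 1 (\<alpha> * fst z + \<beta> * snd z + \<delta>))" for \<alpha> \<beta> \<delta>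
    by (simp add: smooth_def Ck_flat_affine[OF assms])
  from this[of 1 0 "- fst a"] this[of "-1" 0 "fst b"] this[of 0 1 "- snd a"] this[of 0 "-1" "snd b"]
  have "smooth (\<lambda>z. flat c 1 (fst z - fst a) * flat c 1 (fst b - fst z)
     * (flat c 1 (snd z - snd a) * flat c 1 (snd b - snd z)))"
    by (intro smooth_mult) (simp_all add: algebra_simps)
  then show ?thesis
    by (simp add: bump_def[abs_def])
qed

lemma mem_box_plane:
  fixes a b z :: plane
  shows "z \<in> box a b \<longleftrightarrow> fst a < fst z \<and> fst z < fst b \<and> snd a < snd z \<and> snd z < snd b"
  by (cases a; cases b; cases z) (auto simp: mem_box Basis_prod_def ball_Un)

lemma bump_outside: "z \<notin> box a b \<Longrightarrow> bump c a b z = 0"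
  by (auto simp: bump_def flat_def mem_box_plane)

lemma bump_bounds:
  assumes "c > 0"
  shows "0 \<le> bump c a b z" "bump c a b z \<le> 1"
proof -
  have "0 \<le> flat c 1 x" "flat c 1 x \<le> 1" for x
    using assms by (auto simp: flat_def)
  then show "0 \<le> bump c a b z" "bump c a b z \<le> 1"
    unfolding bump_def by (auto intro!: mult_le_one mult_nonneg_nonneg)
qed

text \<open>For fixed x > 0, exp (- c / x) tends to 1 as c tends to 0, and outside the box every
  term is 0. \<open>Suc n\<close> keeps c positive; for c = 0 the factors would be step
  functions.\<close>

lemma bump_tendsto_indicator:
  "(\<lambda>n. bump (1 / real (Suc n)) a b z) \<longlonglongrightarrow> indicator (box a b) z"
proof (cases "z \<in> box a b")
  case True
  have "(\<lambda>n. flat (1 / real (Suc n)) 1 x) \<longlonglongrightarrow> 1" if "x > 0" for x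
  proof -
    have "(\<lambda>n. exp (- (1 / real (Suc n)) / x)) \<longlonglongrightarrow> exp (- 0 / x)"
      using that by (intro tendsto_intros lim_1_over_n[THEN LIMSEQ_Suc]) auto
    then show ?thesis
      using that by (simp add: flat_def)
  qed
  then have "(\<lambda>n. bump (1 / real (Suc n)) a b z) \<longlonglongrightarrow> 1 * 1 * (1 * 1)"
    using True unfolding bump_def mem_box_plane by (intro tendsto_mult) auto
  then show ?thesis
    using True by simp
qed (simp add: bump_outside)

lemma test_function_bump:
  assumes "c > 0" "cbox a b \<subseteq> \<Omega>"
  shows "test_function \<Omega> (bump c a b)"
  unfolding test_function_def
proof (intro conjI exI[of _ "cbox a b"] allI impI)
  show "bump c a b z = 0" if "z \<notin> cbox a b" for z
    using that box_subset_cbox by (intro bump_outside) blast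
qed (use assms smooth_bump in auto)

subsection \<open>Uniqueness of weak gradients\<close>

lemma sigma_finite_lebesgue: "sigma_finite_measure lebesgue"
proof
  obtain A :: "'a set set" where "countable A" "A \<subseteq> sets lborel" "\<Union>A = UNIV"
    "\<forall>a\<in>A. emeasure lborel a \<noteq> \<infinity>"
    using lborel.sigma_finite_countable by auto
  then show "\<exists>A::'a set set. countable A \<and> A \<subseteq> sets lebesgue \<and> \<Union>A = space lebesgue
      \<and> (\<forall>a\<in>A. emeasure lebesgue a \<noteq> \<infinity>)"
    by (intro exI[of _ A]) (auto simp: subset_iff emeasure_completion main_part_sets)
qed

text \<open>Open boxes are an intersection-stable generator of the Borel sets, and the sets over
  which \<open>v\<close> integrates to 0 are closed under countable disjoint unions and, thanks to
  \<open>total\<close>, under complements. A function all of whose set integrals vanish is 0 almost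
  everywhere.\<close>

lemma AE_eq_0_if_box_integrals_eq_0:
  fixes v :: "'a::euclidean_space \<Rightarrow> 'b::euclidean_space"
  assumes v: "integrable lebesgue v"
    and total: "(\<integral>z. v z \<partial>lebesgue) = 0"
    and box: "\<And>a b. (\<integral>z. indicator (box a b) z *\<^sub>R v z \<partial>lebesgue) = 0"
  shows "AE z in lebesgue. v z = 0"
proof (rule sigma_finite_measure.density_zero[OF sigma_finite_lebesgue v])
  have sets: "A \<in> sets lebesgue" if "A \<in> sigma_sets UNIV (range (\<lambda>(a, b). box a b))" for A :: "'a set"
    using that sets_completionI_sets[of A lborel] by (simp add: borel_eq_box)
  have borel: "(\<integral>z. indicator A z *\<^sub>R v z \<partial>lebesgue) = 0" if "A \<in> sets borel" for A
  proof -
    have "Int_stable (range (\<lambda>(a, b). box a b :: 'a set))"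
      by (auto simp: Int_stable_def box_Int_box)
    moreover have "range (\<lambda>(a, b). box a b :: 'a set) \<subseteq> Pow UNIV"
      by simp
    moreover have "A \<in> sigma_sets UNIV (range (\<lambda>(a, b). box a b))"
      using that by (simp add: borel_eq_box)
    ultimately show ?thesis
    proof (induction rule: sigma_sets_induct_disjoint)
      case (basic A)
      then show ?case using box by auto
    next
      case empty
      then show ?case by simp
    next
      case (compl A)
      then have A: "A \<in> sets lebesgue"
        by (intro sets)
      have "(\<integral>z. indicator (UNIV - A) z *\<^sub>R v z \<partial>lebesgue)
          = (\<integral>z. v z - indicator A z *\<^sub>R v z \<partial>lebesgue)"
        by (intro Bochner_Integration.integral_cong) (auto split: split_indicator)
      also have "\<dots> = 0"
        using compl total integrable_mult_indicator[OF A v]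
        by (subst Bochner_Integration.integral_diff[OF v]) auto
      finally show ?case .
    next
      case (union A)
      have A: "A i \<in> sets lebesgue" for i
        using union by (intro sets) auto
      have "set_lebesgue_integral lebesgue (\<Union>i. A i) v = (\<Sum>i. set_lebesgue_integral lebesgue (A i) v)"
      proof (rule lebesgue_integral_countable_add)
        show "A i \<inter> A j = {}" if "i \<noteq> j" for i j
          using union(1) that by (auto simp: disjoint_family_on_def)
        show "set_integrable lebesgue (\<Union>i. A i) v"
          unfolding set_integrable_def by (intro integrable_mult_indicator v) (use A in auto)
      qed (rule A)
      then show ?case
        using union by (simp add: set_lebesgue_integral_def)
    qed
  qed
  fix A :: "'a set"
  assume "A \<in> sets lebesgue"
  \<comment> \<open>A Lebesgue set is a Borel set up to part of a null set, so the Borel case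
    decides the integral over it.\<close>
  then obtain S N N' where A: "A = S \<union> N" "N \<subseteq> N'" "N' \<in> null_sets lborel" "S \<in> sets lborel"
    by (rule sets_completionE)
  have "AE z in lebesgue. z \<notin> N'"
    using A(3) by (intro AE_not_in null_sets_completionI)
  then have "AE z in lebesgue. indicator A z *\<^sub>R v z = indicator S z *\<^sub>R v z"
    by eventually_elim (use A in \<open>auto split: split_indicator\<close>)
  moreover have "S \<in> sets lebesgue"
    using A(4) by (rule sets_completionI_sets)
  ultimately have "(\<integral>z. indicator A z *\<^sub>R v z \<partial>lebesgue) = (\<integral>z. indicator S z *\<^sub>R v z \<partial>lebesgue)"
    using v \<open>A \<in> sets lebesgue\<close>
    by (intro integral_cong_AE borel_measurable_scaleR borel_measurable_indicator borel_measurable_integrable)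
  then show "set_lebesgue_integral lebesgue A v = 0"
    using borel A(4) by (simp add: set_lebesgue_integral_def)
qed

lemma (in finite_measure) L2_integrable:
  assumes v: "v \<in> L2 M"
  shows "integrable M v"
proof (rule Bochner_Integration.integrable_bound)
  show "integrable M (\<lambda>z. 1 + (norm (v z))\<^sup>2)"
    using v by (intro Bochner_Integration.integrable_add L2_integrable_square) auto
  have "norm x \<le> 1 + (norm x)\<^sup>2" for x :: 'b
    using sum_squares_bound[of "norm x" 1] by (simp add: algebra_simps) (smt (verit) norm_ge_zero)
  then show "AE z in M. norm (v z) \<le> norm (1 + (norm (v z))\<^sup>2)"
    by (intro AE_I2) (simp add: abs_of_nonneg)
qed (use v in measurable)

lemma (in finite_measure) bounded_in_L2:
  assumes v: "v \<in> borel_measurable M" and bound: "\<And>z. z \<in> space M \<Longrightarrow> norm (v z) \<le> B"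
  shows "v \<in> L2 M"
proof -
  have "integrable M (\<lambda>z. (norm (v z))\<^sup>2)"
  proof (rule integrable_const_bound)
    show "AE z in M. norm ((norm (v z))\<^sup>2) \<le> B\<^sup>2"
      using bound by (intro AE_I2) (auto intro: power_mono)
  qed (use v in measurable)
  then show ?thesis
    using v by (simp add: L2_def)
qed

lemma L2_scaleR_integrable:
  assumes "v \<in> L2 M" "w \<in> L2 M"
  shows "integrable M (\<lambda>z. v z *\<^sub>R w z)"
proof (rule Bochner_Integration.integrable_bound)
  show "integrable M (\<lambda>z. (norm (v z))\<^sup>2 + (norm (w z))\<^sup>2)"
    using assms by (intro Bochner_Integration.integrable_add L2_integrable_square)
  show "(\<lambda>z. v z *\<^sub>R w z) \<in> borel_measurable M"
    using assms by measurable
  have "norm (v z) * norm (w z) \<le> (norm (v z))\<^sup>2 + (norm (w z))\<^sup>2" for z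
    using sum_squares_bound[of "norm (v z)" "norm (w z)"]
      mult_nonneg_nonneg[OF norm_ge_zero norm_ge_zero, of "v z" "w z"] by linarith
  then have "norm (v z *\<^sub>R w z) \<le> norm ((norm (v z))\<^sup>2 + (norm (w z))\<^sup>2)" for z
    by simp
  then show "AE z in M. norm (v z *\<^sub>R w z) \<le> norm ((norm (v z))\<^sup>2 + (norm (w z))\<^sup>2)"
    by simp
qed

lemma L2_norm_tendsto_0:
  assumes le: "\<And>n. L2_norm M (c n) \<le> g n + h n"
    and lim: "g \<longlonglongrightarrow> 0" "h \<longlonglongrightarrow> 0"
  shows "(\<lambda>n. L2_norm M (c n)) \<longlonglongrightarrow> 0"
proof (rule tendsto_sandwich[OF _ _ tendsto_const])
  show "(\<lambda>n. g n + h n) \<longlonglongrightarrow> 0"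
    using tendsto_add[OF lim] by simp
qed (use le in auto)

text \<open>Boundedness makes Lebesgue measure on the domain finite, so \<open>L2\<close> functions
  are integrable and continuous functions on the plane belong to \<open>L2\<close>. Openness allows
  the domain to be written as a countable union of closed boxes, in which bump functions
  live.\<close>

locale bounded_domain =
  fixes \<Omega> :: "plane set"
  assumes open_domain: "open \<Omega>" and bounded_domain: "bounded \<Omega>"
begin

lemma domain_lebesgue [simp]: "\<Omega> \<in> sets lebesgue"
  using open_domain by (intro sets_completionI_sets) simp

sublocale finite_measure "lebesgue_on \<Omega>"
proof (rule finite_measure_lebesgue_on)
  show "\<Omega> \<in> lmeasurable"
    using open_domain bounded_domain by (intro bounded_set_imp_lmeasurable) auto
qed

lemma continuous_in_L2:
  fixes v :: "plane \<Rightarrow> 'b::euclidean_space"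
  assumes "continuous_on UNIV v"
  shows "v \<in> L2 (lebesgue_on \<Omega>)"
proof -
  have "compact (v ` closure \<Omega>)"
    using assms bounded_domain by (intro compact_continuous_image) (auto intro: continuous_on_subset)
  then obtain B where "\<And>z. z \<in> closure \<Omega> \<Longrightarrow> norm (v z) \<le> B"
    by (metis bounded_iff compact_imp_bounded image_eqI)
  moreover have "v \<in> borel_measurable (lebesgue_on \<Omega>)"
    using assms by (intro continuous_imp_measurable_on_sets_lebesgue) (auto intro: continuous_on_subset)
  ultimately show ?thesis
    using closure_subset by (intro bounded_in_L2[of v B]) auto
qed

lemma smooth_in_L2: "smooth \<phi> \<Longrightarrow> \<phi> \<in> L2 (lebesgue_on \<Omega>)"
  by (intro continuous_in_L2 smooth_continuous_on)

lemma smooth_classical_grad_in_L2: "smooth \<phi> \<Longrightarrow> classical_grad \<phi> \<in> L2 (lebesgue_on \<Omega>)"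
  by (intro continuous_in_L2 smooth_continuous_on_classical_grad)

text \<open>The fundamental lemma of the calculus of variations. Bump functions converge boundedly
  to indicators of boxes, so the integrals over boxes inside the domain vanish; the box criterion
  then applies to the function cut off to one such box, and countably many boxes exhaust the
  domain.\<close>

lemma AE_eq_0_if_test_integrals_eq_0:
  fixes v :: "plane \<Rightarrow> 'b::euclidean_space"
  assumes v: "v \<in> L2 (lebesgue_on \<Omega>)"
    and test: "\<And>\<phi>. test_function \<Omega> \<phi> \<Longrightarrow> (\<integral>z. \<phi> z *\<^sub>R v z \<partial>lebesgue_on \<Omega>) = 0"
  shows "AE z in lebesgue_on \<Omega>. v z = 0"
proof -
  \<comment> \<open>Extension by 0 to the plane, where the box criterion is available.\<close>
  define w where "w z = indicator \<Omega> z *\<^sub>R v z" for z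
  have w: "integrable lebesgue w"
    using L2_integrable[OF v] by (simp add: w_def[abs_def] integrable_restrict_space)
  have test': "(\<integral>z. \<phi> z *\<^sub>R w z \<partial>lebesgue) = 0" if "test_function \<Omega> \<phi>" for \<phi>
    using test[OF that] by (simp add: w_def integral_restrict_space mult.commute)
  have box0: "(\<integral>z. indicator (box a b) z *\<^sub>R w z \<partial>lebesgue) = 0" if ab: "cbox a b \<subseteq> \<Omega>" for a b
  proof -
    have "(\<lambda>n. \<integral>z. bump (1 / real (Suc n)) a b z *\<^sub>R w z \<partial>lebesgue)
        \<longlonglongrightarrow> (\<integral>z. indicator (box a b) z *\<^sub>R w z \<partial>lebesgue)"
    proof (rule integral_dominated_convergence)
      show "integrable lebesgue (\<lambda>z. norm (w z))"
        using w by (rule integrable_norm)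
      show "AE z in lebesgue. (\<lambda>n. bump (1 / real (Suc n)) a b z *\<^sub>R w z)
          \<longlonglongrightarrow> indicator (box a b) z *\<^sub>R w z"
        by (intro AE_I2 tendsto_scaleR bump_tendsto_indicator tendsto_const)
      show "(\<lambda>z. indicator (box a b) z *\<^sub>R w z) \<in> borel_measurable lebesgue"
        using w by (intro borel_measurable_scaleR borel_measurable_indicator borel_measurable_integrable)
          (auto intro: sets_completionI_sets)
      show "(\<lambda>z. bump (1 / real (Suc n)) a b z *\<^sub>R w z) \<in> borel_measurable lebesgue" for n
        using w continuous_imp_measurable_on_sets_lebesgue[OF smooth_continuous_on[OF smooth_bump], of "1 / real (Suc n)" UNIV a b]
        by (intro borel_measurable_scaleR) auto
      show "AE z in lebesgue. norm (bump (1 / real (Suc n)) a b z *\<^sub>R w z) \<le> norm (w z)" for n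
        using bump_bounds[of "1 / real (Suc n)" a b] by (intro AE_I2) (simp add: mult_left_le_one_le)
    qed
    moreover have "(\<integral>z. bump (1 / real (Suc n)) a b z *\<^sub>R w z \<partial>lebesgue) = 0" for n
      using ab by (intro test' test_function_bump) auto
    ultimately show ?thesis
      by (simp add: LIMSEQ_const_iff)
  qed
  have cbox: "AE z in lebesgue. z \<in> cbox a b \<longrightarrow> w z = 0" if ab: "cbox a b \<subseteq> \<Omega>" for a b
  proof -
    have meas: "box a b \<in> sets lebesgue"
      by (intro sets_completionI_sets) simp
    have "AE z in lebesgue. indicator (box a b) z *\<^sub>R w z = 0"
    proof (rule AE_eq_0_if_box_integrals_eq_0)
      show "integrable lebesgue (\<lambda>z. indicator (box a b) z *\<^sub>R w z)"
        by (rule integrable_mult_indicator[OF meas w])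
      show "(\<integral>z. indicator (box a b) z *\<^sub>R w z \<partial>lebesgue) = 0"
        by (rule box0[OF ab])
      fix c d :: plane
      obtain x y where xy: "box a b \<inter> box c d = box x y"
        using box_Int_box[of a b c d] by blast
      have "(\<integral>z. indicator (box x y) z *\<^sub>R w z \<partial>lebesgue) = 0"
      \<comment> \<open>Closures compare \<open>cbox x y\<close> with \<open>cbox a b\<close> only
        if the open box is nonempty; over an empty one the integral is trivially 0.\<close>
      proof (cases "box x y = {}")
        case False
        have "closure (box x y) \<subseteq> closure (box a b)"
          unfolding xy[symmetric] by (intro closure_mono) blast
        moreover have "box a b \<noteq> {}"
          using False xy by blast
        ultimately have "cbox x y \<subseteq> cbox a b"
          using False by (simp add: closure_box)
        then show ?thesis
          using ab by (intro box0) blast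
      qed simp
      then show "(\<integral>z. indicator (box c d) z *\<^sub>R indicator (box a b) z *\<^sub>R w z \<partial>lebesgue) = 0"
        unfolding xy[symmetric] by (simp add: indicator_inter_arith mult.commute)
    qed
    \<comment> \<open>The criterion was applied on the open box, while the covering below consists
      of closed ones; they differ by a null set.\<close>
    moreover have "AE z in lebesgue. z \<notin> cbox a b - box a b"
      using negligible_frontier_interval[of a b] by (intro AE_not_in) (simp add: negligible_iff_null_sets)
    ultimately show ?thesis
      by eventually_elim (auto split: split_indicator_asm)
  qed
  obtain \<D> where D: "countable \<D>" "\<D> \<subseteq> Pow \<Omega>" "\<And>X. X \<in> \<D> \<Longrightarrow> \<exists>a b. X = cbox a b" "\<Union>\<D> = \<Omega>"
    using open_countable_Union_open_cbox[OF open_domain] by blast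
  have "AE z in lebesgue. \<forall>X\<in>\<D>. z \<in> X \<longrightarrow> w z = 0"
  proof (subst AE_ball_countable[OF D(1)], intro ballI)
    fix X assume "X \<in> \<D>"
    then obtain a b where "X = cbox a b" "cbox a b \<subseteq> \<Omega>"
      using D(2,3) by blast
    then show "AE z in lebesgue. z \<in> X \<longrightarrow> w z = 0"
      using cbox by simp
  qed
  then have "AE z in lebesgue. z \<in> \<Omega> \<longrightarrow> v z = 0"
  proof eventually_elim
    case (elim z)
    show ?case
    proof
      assume z: "z \<in> \<Omega>"
      then have "w z = 0"
        using elim D(4) by blast
      then show "v z = 0"
        using z by (simp add: w_def)
    qed
  qed
  then show ?thesis
    by (subst AE_restrict_space_iff) auto
qed

lemma is_weak_grad_unique:
  assumes "is_weak_grad \<Omega> v G" "is_weak_grad \<Omega> v G'"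
  shows "AE z in lebesgue_on \<Omega>. G z = G' z"
proof -
  have L2: "G \<in> L2 (lebesgue_on \<Omega>)" "G' \<in> L2 (lebesgue_on \<Omega>)"
    using assms by (auto simp: is_weak_grad_def)
  have "AE z in lebesgue_on \<Omega>. G z - G' z = 0"
  proof (rule AE_eq_0_if_test_integrals_eq_0)
    fix \<phi> assume \<phi>: "test_function \<Omega> \<phi>"
    then have "\<phi> \<in> L2 (lebesgue_on \<Omega>)"
      by (simp add: test_function_def smooth_in_L2)
    then show "(\<integral>z. \<phi> z *\<^sub>R (G z - G' z) \<partial>lebesgue_on \<Omega>) = 0"
      using assms \<phi> L2 by (simp add: scaleR_diff_right is_weak_grad_def L2_scaleR_integrable)
  qed (intro L2_diff L2)
  then show ?thesis by simp
qed

lemma is_weak_grad_diff: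
  assumes v: "v \<in> L2 (lebesgue_on \<Omega>)" "is_weak_grad \<Omega> v G"
    and w: "w \<in> L2 (lebesgue_on \<Omega>)" "is_weak_grad \<Omega> w H"
  shows "is_weak_grad \<Omega> (\<lambda>z. v z - w z) (\<lambda>z. G z - H z)"
  unfolding is_weak_grad_def
proof (intro conjI allI impI)
  have G: "G \<in> L2 (lebesgue_on \<Omega>)" and H: "H \<in> L2 (lebesgue_on \<Omega>)"
    using assms by (auto simp: is_weak_grad_def)
  show "(\<lambda>z. G z - H z) \<in> L2 (lebesgue_on \<Omega>)"
    by (intro L2_diff G H)
  fix \<phi> assume \<phi>: "test_function \<Omega> \<phi>"
  then have "\<phi> \<in> L2 (lebesgue_on \<Omega>)" "classical_grad \<phi> \<in> L2 (lebesgue_on \<Omega>)"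
    by (simp_all add: test_function_def smooth_in_L2 smooth_classical_grad_in_L2)
  then show "(\<integral>z. (v z - w z) *\<^sub>R classical_grad \<phi> z \<partial>lebesgue_on \<Omega>)
      = - (\<integral>z. \<phi> z *\<^sub>R (G z - H z) \<partial>lebesgue_on \<Omega>)"
    using v w G H \<phi>
    by (simp add: scaleR_diff_left scaleR_diff_right L2_scaleR_integrable is_weak_grad_def)
qed

section \<open>The chosen gradient, traces and the spaces \<open>H1_0\<close>\<close>

lemma H1_L2: "v \<in> H1 \<Omega> \<Longrightarrow> v \<in> L2 (lebesgue_on \<Omega>)"
  by (simp add: H1_def)

lemma is_weak_grad_grad: "v \<in> H1 \<Omega> \<Longrightarrow> is_weak_grad \<Omega> v (grad \<Omega> v)"
  using someI_ex[of "is_weak_grad \<Omega> v"] unfolding H1_def grad_def by auto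

lemma grad_L2: "v \<in> H1 \<Omega> \<Longrightarrow> grad \<Omega> v \<in> L2 (lebesgue_on \<Omega>)"
  using is_weak_grad_grad by (simp add: is_weak_grad_def)

lemma grad_perp_L2:
  assumes "v \<in> H1 \<Omega>"
  shows "grad_perp \<Omega> v \<in> L2 (lebesgue_on \<Omega>)"
proof -
  have "(\<lambda>p :: plane. (snd p, - fst p)) \<in> borel_measurable borel"
    by (intro borel_measurable_continuous_onI continuous_intros)
  then have "(\<lambda>z. (snd (grad \<Omega> v z), - fst (grad \<Omega> v z))) \<in> borel_measurable (lebesgue_on \<Omega>)"
    by (rule measurable_compose[OF L2_measurable[OF grad_L2[OF assms]]])
  moreover have "norm (grad_perp \<Omega> v z) = norm (grad \<Omega> v z)" for z
    by (simp add: grad_perp_def norm_prod_def add.commute)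
  ultimately show ?thesis
    using grad_L2[OF assms] by (simp add: L2_def grad_perp_def[abs_def])
qed

lemma H1_diff:
  assumes "v \<in> H1 \<Omega>" "w \<in> H1 \<Omega>"
  shows "(\<lambda>z. v z - w z) \<in> H1 \<Omega>"
  using assms is_weak_grad_diff[OF H1_L2 is_weak_grad_grad H1_L2 is_weak_grad_grad]
  by (auto simp: H1_def intro: L2_diff)

text \<open>\<open>grad\<close> is picked by \<open>SOME\<close>, so the two sides come from
  unrelated choices; both are weak gradients of the same function.\<close>

lemma AE_grad_diff:
  assumes "v \<in> H1 \<Omega>" "w \<in> H1 \<Omega>"
  shows "AE z in lebesgue_on \<Omega>. grad \<Omega> (\<lambda>z. v z - w z) z = grad \<Omega> v z - grad \<Omega> w z"
  using assms
  by (intro is_weak_grad_unique[of "\<lambda>z. v z - w z"] is_weak_grad_diff is_weak_grad_grad H1_diff H1_L2)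

lemma AE_grad_perp_diff:
  assumes "v \<in> H1 \<Omega>" "w \<in> H1 \<Omega>"
  shows "AE z in lebesgue_on \<Omega>. grad_perp \<Omega> (\<lambda>z. v z - w z) z = grad_perp \<Omega> v z - grad_perp \<Omega> w z"
  using AE_grad_diff[OF assms] by eventually_elim (simp add: grad_perp_def)

text \<open>The approximating sequences are subtracted. The gradient limit is the delicate one: it
  mentions \<open>grad\<close> of the difference, so even closure of \<open>H1_0\<close> under
  differences rests on uniqueness of weak gradients.\<close>

lemma has_trace_diff:
  assumes v: "has_trace \<Omega> v \<tau>" and w: "has_trace \<Omega> w \<sigma>"
  shows "has_trace \<Omega> (\<lambda>z. v z - w z) (\<lambda>z. \<tau> z - \<sigma> z)"
proof -
  let ?B = "arc_length_on (frontier \<Omega>)"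
  obtain \<phi> where H1: "v \<in> H1 \<Omega>" "\<tau> \<in> L2 ?B"
    and \<phi>: "\<And>n. smooth (\<phi> n)" "\<And>n. \<phi> n \<in> L2 ?B"
    and \<phi>_lim: "(\<lambda>n. L2_norm (lebesgue_on \<Omega>) (\<lambda>z. \<phi> n z - v z)) \<longlonglongrightarrow> 0"
      "(\<lambda>n. L2_norm (lebesgue_on \<Omega>) (\<lambda>z. classical_grad (\<phi> n) z - grad \<Omega> v z)) \<longlonglongrightarrow> 0"
      "(\<lambda>n. L2_norm ?B (\<lambda>z. \<phi> n z - \<tau> z)) \<longlonglongrightarrow> 0"
    using v unfolding has_trace_def by auto
  obtain \<eta> where H1': "w \<in> H1 \<Omega>" "\<sigma> \<in> L2 ?B"
    and \<eta>: "\<And>n. smooth (\<eta> n)" "\<And>n. \<eta> n \<in> L2 ?B"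
    and \<eta>_lim: "(\<lambda>n. L2_norm (lebesgue_on \<Omega>) (\<lambda>z. \<eta> n z - w z)) \<longlonglongrightarrow> 0"
      "(\<lambda>n. L2_norm (lebesgue_on \<Omega>) (\<lambda>z. classical_grad (\<eta> n) z - grad \<Omega> w z)) \<longlonglongrightarrow> 0"
      "(\<lambda>n. L2_norm ?B (\<lambda>z. \<eta> n z - \<sigma> z)) \<longlonglongrightarrow> 0"
    using w unfolding has_trace_def by auto
  have lim: "(\<lambda>n. L2_norm (lebesgue_on \<Omega>) (\<lambda>z. (\<phi> n z - \<eta> n z) - (v z - w z))) \<longlonglongrightarrow> 0"
  proof (rule L2_norm_tendsto_0[OF _ \<phi>_lim(1) \<eta>_lim(1)])
    show "L2_norm (lebesgue_on \<Omega>) (\<lambda>z. (\<phi> n z - \<eta> n z) - (v z - w z))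
        \<le> L2_norm (lebesgue_on \<Omega>) (\<lambda>z. \<phi> n z - v z) + L2_norm (lebesgue_on \<Omega>) (\<lambda>z. \<eta> n z - w z)" for n
      using L2_norm_diff_le[OF L2_diff[OF smooth_in_L2[OF \<phi>(1)[of n]] H1_L2[OF H1(1)]]
          L2_diff[OF smooth_in_L2[OF \<eta>(1)[of n]] H1_L2[OF H1'(1)]]]
      by (simp add: algebra_simps)
  qed
  have lim_boundary: "(\<lambda>n. L2_norm ?B (\<lambda>z. (\<phi> n z - \<eta> n z) - (\<tau> z - \<sigma> z))) \<longlonglongrightarrow> 0"
  proof (rule L2_norm_tendsto_0[OF _ \<phi>_lim(3) \<eta>_lim(3)])
    show "L2_norm ?B (\<lambda>z. (\<phi> n z - \<eta> n z) - (\<tau> z - \<sigma> z))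
        \<le> L2_norm ?B (\<lambda>z. \<phi> n z - \<tau> z) + L2_norm ?B (\<lambda>z. \<eta> n z - \<sigma> z)" for n
      using L2_norm_diff_le[OF L2_diff[OF \<phi>(2)[of n] H1(2)] L2_diff[OF \<eta>(2)[of n] H1'(2)]]
      by (simp add: algebra_simps)
  qed
  have lim_grad: "(\<lambda>n. L2_norm (lebesgue_on \<Omega>) (\<lambda>z. classical_grad (\<lambda>z. \<phi> n z - \<eta> n z) z
      - grad \<Omega> (\<lambda>z. v z - w z) z)) \<longlonglongrightarrow> 0"
  proof (rule L2_norm_tendsto_0[OF _ \<phi>_lim(2) \<eta>_lim(2)])
    fix n
    note L2 = smooth_classical_grad_in_L2[OF \<phi>(1)[of n]] grad_L2[OF H1(1)]
      smooth_classical_grad_in_L2[OF \<eta>(1)[of n]] grad_L2[OF H1'(1)]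
    have "L2_norm (lebesgue_on \<Omega>) (\<lambda>z. classical_grad (\<lambda>z. \<phi> n z - \<eta> n z) z
          - grad \<Omega> (\<lambda>z. v z - w z) z)
        = L2_norm (lebesgue_on \<Omega>) (\<lambda>z. (classical_grad (\<phi> n) z - grad \<Omega> v z)
          - (classical_grad (\<eta> n) z - grad \<Omega> w z))"
    proof (rule L2_norm_cong_AE)
      show "AE z in lebesgue_on \<Omega>. classical_grad (\<lambda>z. \<phi> n z - \<eta> n z) z
          - grad \<Omega> (\<lambda>z. v z - w z) z
        = (classical_grad (\<phi> n) z - grad \<Omega> v z) - (classical_grad (\<eta> n) z - grad \<Omega> w z)"
        using AE_grad_diff[OF H1(1) H1'(1)]
        by eventually_elim (simp add: classical_grad_diff smooth_differentiable \<phi> \<eta>)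
      show "(\<lambda>z. classical_grad (\<lambda>z. \<phi> n z - \<eta> n z) z - grad \<Omega> (\<lambda>z. v z - w z) z)
          \<in> borel_measurable (lebesgue_on \<Omega>)"
        by (intro L2_measurable L2_diff[OF smooth_classical_grad_in_L2 grad_L2] smooth_diff \<phi> \<eta> H1_diff H1 H1')
    qed (intro L2_measurable L2_diff L2)
    also have "\<dots> \<le> L2_norm (lebesgue_on \<Omega>) (\<lambda>z. classical_grad (\<phi> n) z - grad \<Omega> v z)
        + L2_norm (lebesgue_on \<Omega>) (\<lambda>z. classical_grad (\<eta> n) z - grad \<Omega> w z)"
      by (intro L2_norm_diff_le L2_diff L2)
    finally show "L2_norm (lebesgue_on \<Omega>) (\<lambda>z. classical_grad (\<lambda>z. \<phi> n z - \<eta> n z) z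
          - grad \<Omega> (\<lambda>z. v z - w z) z)
        \<le> L2_norm (lebesgue_on \<Omega>) (\<lambda>z. classical_grad (\<phi> n) z - grad \<Omega> v z)
        + L2_norm (lebesgue_on \<Omega>) (\<lambda>z. classical_grad (\<eta> n) z - grad \<Omega> w z)" .
  qed
  show ?thesis
    unfolding has_trace_def
    by (intro conjI allI exI[of _ "\<lambda>n z. \<phi> n z - \<eta> n z"] H1_diff H1 H1' L2_diff smooth_diff \<phi> \<eta>
        lim lim_grad lim_boundary)
qed

lemma H1_0_H1: "v \<in> H1_0 \<Omega> \<Gamma> \<Longrightarrow> v \<in> H1 \<Omega>"
  by (simp add: H1_0_def)

lemma H1_0_diff:
  assumes "v \<in> H1_0 \<Omega> \<Gamma>" "w \<in> H1_0 \<Omega> \<Gamma>"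
  shows "(\<lambda>z. v z - w z) \<in> H1_0 \<Omega> \<Gamma>"
proof -
  obtain \<tau> \<sigma> where tr: "has_trace \<Omega> v \<tau>" "has_trace \<Omega> w \<sigma>"
    and 0: "AE z in arc_length_on \<Gamma>. \<tau> z = 0" "AE z in arc_length_on \<Gamma>. \<sigma> z = 0"
    using assms unfolding H1_0_def by auto
  have "AE z in arc_length_on \<Gamma>. \<tau> z - \<sigma> z = 0"
    using 0 by eventually_elim simp
  then show ?thesis
    unfolding H1_0_def using assms H1_diff has_trace_diff[OF tr] H1_0_H1 by auto
qed

end

subsection \<open>Differences of fluxes and of Helmholtz decompositions\<close>

text \<open>Serves to make the difference of two competitors in a best approximation again a
  competitor.\<close>

lemma findim_subspace_diff:
  assumes V: "findim_subspace \<Omega> X V"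
    and X: "\<And>v w. v \<in> X \<Longrightarrow> w \<in> X \<Longrightarrow> (\<lambda>z. v z - w z) \<in> X"
    and vw: "v \<in> V" "w \<in> V"
  shows "(\<lambda>z. v z - w z) \<in> V"
proof -
  obtain B where B: "V = {v \<in> X. \<exists>c. AE z in lebesgue_on \<Omega>. v z = (\<Sum>b\<in>B. c b * b z)}"
    using V unfolding findim_subspace_def by blast
  obtain c d where "AE z in lebesgue_on \<Omega>. v z = (\<Sum>b\<in>B. c b * b z)"
    and "AE z in lebesgue_on \<Omega>. w z = (\<Sum>b\<in>B. d b * b z)"
    using vw unfolding B by blast
  then have "AE z in lebesgue_on \<Omega>. v z - w z = (\<Sum>b\<in>B. (c b - d b) * b z)"
    by eventually_elim (simp add: left_diff_distrib sum_subtractf)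
  moreover have "(\<lambda>z. v z - w z) \<in> X"
    using vw X unfolding B by blast
  ultimately show ?thesis
    unfolding B by (intro CollectI conjI exI[of _ "\<lambda>b. c b - d b"])
qed

text \<open>The infimum in \<open>best_err\<close> is one of reals and is meaningful only over a
  nonempty set; the zero combination provides an element.\<close>

lemma findim_subspace_nonempty:
  assumes V: "findim_subspace \<Omega> X V"
    and X: "\<And>v w. v \<in> X \<Longrightarrow> w \<in> X \<Longrightarrow> (\<lambda>z. v z - w z) \<in> X" and "X \<noteq> {}"
  shows "V \<noteq> {}"
proof -
  obtain B where B: "V = {v \<in> X. \<exists>c. AE z in lebesgue_on \<Omega>. v z = (\<Sum>b\<in>B. c b * b z)}"
    using V unfolding findim_subspace_def by blast
  obtain x where x: "x \<in> X"
    using \<open>X \<noteq> {}\<close> by blast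
  have "(\<lambda>z. 0) \<in> X"
    using X[OF x x] by simp
  then have "(\<lambda>z. 0) \<in> V"
    unfolding B by (intro CollectI conjI exI[of _ "\<lambda>b. 0"]) auto
  then show ?thesis by blast
qed

lemma dual_norm_leD:
  assumes "dual_norm \<Omega> \<Gamma> F \<le> ennreal K" "0 \<le> K" "\<phi> \<in> H1_0 \<Omega> \<Gamma>" "nonzero (lebesgue_on \<Omega>) \<phi>"
  shows "\<bar>F \<phi>\<bar> / L2_norm (lebesgue_on \<Omega>) (grad \<Omega> \<phi>) \<le> K"
proof -
  have "ennreal (\<bar>F \<phi>\<bar> / L2_norm (lebesgue_on \<Omega>) (grad \<Omega> \<phi>)) \<le> dual_norm \<Omega> \<Gamma> F"
    unfolding dual_norm_def using assms(3,4) by (intro SUP_upper) simp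
  then show ?thesis
    using assms(1,2) by (metis ennreal_le_iff order_trans)
qed

text \<open>For a nonzero \<open>s\<close>, the supremum of the quotients is at least
  \<open>k\<close> and at most \<open>E / L2_norm M s\<close>; a null \<open>s\<close> has norm 0.
  The bound is phrased with quotients so that \<open>n p = 0\<close>, where division returns 0,
  needs no separate case.\<close>

lemma inf_sup_norm_le:
  assumes inf_sup: "ennreal k \<le> (INF s\<in>{s \<in> R. nonzero M s}. SUP p\<in>P.
      ennreal (\<bar>b s p\<bar> / (L2_norm M s * n p)))"
    and s: "s \<in> R" "s \<in> L2 M" and "0 \<le> E"
    and bound: "\<And>p. p \<in> P \<Longrightarrow> \<bar>b s p\<bar> / n p \<le> E"
  shows "k * L2_norm M s \<le> E"
proof (cases "nonzero M s")
  case True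
  then have pos: "L2_norm M s > 0"
    using L2_norm_zero_iff[OF s(2)] L2_norm_nonneg[of M s] by (auto simp: nonzero_def order.order_iff_strict)
  have "ennreal k \<le> (SUP p\<in>P. ennreal (\<bar>b s p\<bar> / (L2_norm M s * n p)))"
    using s True by (intro order_trans[OF inf_sup] INF_lower) simp
  also have "\<dots> \<le> ennreal (E / L2_norm M s)"
  proof (rule SUP_least)
    fix p assume "p \<in> P"
    then have "\<bar>b s p\<bar> / n p / L2_norm M s \<le> E / L2_norm M s"
      using bound pos by (intro divide_right_mono) auto
    then show "ennreal (\<bar>b s p\<bar> / (L2_norm M s * n p)) \<le> ennreal (E / L2_norm M s)"
      by (intro ennreal_leI) (simp add: mult.commute)
  qed
  finally have "k \<le> E / L2_norm M s"
    using pos \<open>0 \<le> E\<close> by (subst (asm) ennreal_le_iff) auto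
  then show ?thesis
    using pos by (simp add: field_simps)
next
  case False
  then show ?thesis
    using L2_norm_zero_iff[OF s(2)] \<open>0 \<le> E\<close> by (simp add: nonzero_def)
qed

text \<open>Since \<open>f\<close> may be nonlinear, a difference of fluxes need not be a flux; this
  is why the inf-sup condition is posed on the span.\<close>

lemma flux_span_diff:
  assumes "v \<in> U" "w \<in> U"
  shows "(\<lambda>z. f (v z) - f (w z)) \<in> flux_span f U"
proof -
  have "(\<lambda>z. f (v z) - f (w z))
      = (\<lambda>z. \<Sum>i<2. (if i = (0::nat) then 1 else - 1) *\<^sub>R f ((if i = 0 then v else w) z))"
    by (simp add: numeral_2_eq_2)
  moreover have "\<forall>i<2. (if i = (0::nat) then v else w) \<in> U"
    using assms by simp
  ultimately show ?thesis
    unfolding flux_span_def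
    by (intro CollectI exI[of _ 2] exI[of _ "\<lambda>i. if i = 0 then 1 else - 1"]
        exI[of _ "\<lambda>i. if i = 0 then v else w"] conjI)
qed

context bounded_domain
begin

lemma L2_inner_grad_diff:
  assumes "v \<in> H1 \<Omega>" "w \<in> H1 \<Omega>" "x \<in> L2 (lebesgue_on \<Omega>)"
  shows "L2_inner (lebesgue_on \<Omega>) (grad \<Omega> (\<lambda>z. v z - w z)) x
    = L2_inner (lebesgue_on \<Omega>) (grad \<Omega> v) x - L2_inner (lebesgue_on \<Omega>) (grad \<Omega> w) x"
  using assms
  by (subst L2_inner_cong_AE[OF AE_grad_diff])
    (simp_all add: L2_inner_diff_left grad_L2 H1_diff L2_diff)

lemma L2_inner_grad_perp_diff:
  assumes "v \<in> H1 \<Omega>" "w \<in> H1 \<Omega>" "x \<in> L2 (lebesgue_on \<Omega>)"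
  shows "L2_inner (lebesgue_on \<Omega>) (grad_perp \<Omega> (\<lambda>z. v z - w z)) x
    = L2_inner (lebesgue_on \<Omega>) (grad_perp \<Omega> v) x - L2_inner (lebesgue_on \<Omega>) (grad_perp \<Omega> w) x"
  using assms
  by (subst L2_inner_cong_AE[OF AE_grad_perp_diff])
    (simp_all add: L2_inner_diff_left grad_perp_L2 H1_diff L2_diff)

text \<open>Subtracting two decompositions creates cross terms between the potential of one and the
  stream function of the other. They vanish because \<open>grad \<Omega> q\<close> and
  \<open>v\<close> have the same pairing with every such \<open>grad \<Omega> \<phi>\<close>, which
  leaves nothing for the rotational part.\<close>

lemma helmholtz_orthogonal:
  assumes helm: "helmholtz \<Omega> \<Gamma>I \<Gamma>C v q \<psi>" and \<phi>: "\<phi> \<in> H1_0 \<Omega> \<Gamma>C"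
  shows "L2_inner (lebesgue_on \<Omega>) (grad \<Omega> \<phi>) (grad_perp \<Omega> \<psi>) = 0"
proof -
  have L2: "v \<in> L2 (lebesgue_on \<Omega>)" "grad \<Omega> q \<in> L2 (lebesgue_on \<Omega>)"
      "grad_perp \<Omega> \<psi> \<in> L2 (lebesgue_on \<Omega>)" "grad \<Omega> \<phi> \<in> L2 (lebesgue_on \<Omega>)"
    using helm \<phi> by (auto simp: helmholtz_def intro: grad_L2 grad_perp_L2 H1_0_H1)
  have "L2_inner (lebesgue_on \<Omega>) (grad \<Omega> q) (grad \<Omega> \<phi>) = L2_inner (lebesgue_on \<Omega>) v (grad \<Omega> \<phi>)"
    using helm \<phi> by (simp add: helmholtz_def)
  also have "\<dots> = L2_inner (lebesgue_on \<Omega>) (\<lambda>z. grad \<Omega> q z + grad_perp \<Omega> \<psi> z) (grad \<Omega> \<phi>)"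
    using helm by (intro L2_inner_cong_AE L2 L2_add) (simp add: helmholtz_def)
  also have "\<dots> = L2_inner (lebesgue_on \<Omega>) (grad \<Omega> q) (grad \<Omega> \<phi>)
      + L2_inner (lebesgue_on \<Omega>) (grad_perp \<Omega> \<psi>) (grad \<Omega> \<phi>)"
    by (rule L2_inner_add_left[OF L2(2-4)])
  finally show ?thesis
    by (simp add: L2_inner_commute)
qed

lemma helmholtz_diff:
  assumes v: "helmholtz \<Omega> \<Gamma>I \<Gamma>C v q \<psi>" and w: "helmholtz \<Omega> \<Gamma>I \<Gamma>C w p \<theta>"
  shows "helmholtz \<Omega> \<Gamma>I \<Gamma>C (\<lambda>z. v z - w z) (\<lambda>z. q z - p z) (\<lambda>z. \<psi> z - \<theta> z)"
proof -
  have L2: "v \<in> L2 (lebesgue_on \<Omega>)" "w \<in> L2 (lebesgue_on \<Omega>)"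
    and H1_0: "q \<in> H1_0 \<Omega> \<Gamma>C" "p \<in> H1_0 \<Omega> \<Gamma>C" "\<psi> \<in> H1_0 \<Omega> \<Gamma>I" "\<theta> \<in> H1_0 \<Omega> \<Gamma>I"
    using v w by (simp_all add: helmholtz_def)
  note H1 = H1_0[THEN H1_0_H1]
  have AE: "AE z in lebesgue_on \<Omega>. v z - w z
      = grad \<Omega> (\<lambda>z. q z - p z) z + grad_perp \<Omega> (\<lambda>z. \<psi> z - \<theta> z) z"
  proof -
    have "AE z in lebesgue_on \<Omega>. v z = grad \<Omega> q z + grad_perp \<Omega> \<psi> z"
      "AE z in lebesgue_on \<Omega>. w z = grad \<Omega> p z + grad_perp \<Omega> \<theta> z"
      using v w by (simp_all add: helmholtz_def)
    then show ?thesis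
      using AE_grad_diff[OF H1(1,2)] AE_grad_perp_diff[OF H1(3,4)] by eventually_elim simp
  qed
  have orth: "L2_inner (lebesgue_on \<Omega>) (grad \<Omega> (\<lambda>z. q z - p z)) (grad_perp \<Omega> (\<lambda>z. \<psi> z - \<theta> z)) = 0"
  proof -
    have "L2_inner (lebesgue_on \<Omega>) (grad_perp \<Omega> (\<lambda>z. \<psi> z - \<theta> z)) (grad \<Omega> (\<lambda>z. q z - p z)) = 0"
      using helmholtz_orthogonal[OF v H1_0_diff[OF H1_0(1,2)]]
        helmholtz_orthogonal[OF w H1_0_diff[OF H1_0(1,2)]]
      by (subst L2_inner_grad_perp_diff[OF H1(3,4) grad_L2[OF H1_diff[OF H1(1,2)]]])
        (simp add: L2_inner_commute)
    then show ?thesis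
      by (simp add: L2_inner_commute)
  qed
  have "L2_inner (lebesgue_on \<Omega>) (grad \<Omega> (\<lambda>z. q z - p z)) (grad \<Omega> \<phi>)
      = L2_inner (lebesgue_on \<Omega>) (\<lambda>z. v z - w z) (grad \<Omega> \<phi>)" if \<phi>: "\<phi> \<in> H1_0 \<Omega> \<Gamma>C" for \<phi>
    using v w \<phi> L2_inner_grad_diff[OF H1(1,2) grad_L2[OF H1_0_H1[OF \<phi>]]]
      L2_inner_diff_left[OF L2 grad_L2[OF H1_0_H1[OF \<phi>]]]
    by (simp add: helmholtz_def)
  moreover have "L2_inner (lebesgue_on \<Omega>) (grad_perp \<Omega> (\<lambda>z. \<psi> z - \<theta> z)) (grad_perp \<Omega> \<nu>)
      = L2_inner (lebesgue_on \<Omega>) (\<lambda>z. v z - w z) (grad_perp \<Omega> \<nu>)" if \<nu>: "\<nu> \<in> H1_0 \<Omega> \<Gamma>I" for \<nu>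
    using v w \<nu> L2_inner_grad_perp_diff[OF H1(3,4) grad_perp_L2[OF H1_0_H1[OF \<nu>]]]
      L2_inner_diff_left[OF L2 grad_perp_L2[OF H1_0_H1[OF \<nu>]]]
    by (simp add: helmholtz_def)
  ultimately show ?thesis
    unfolding helmholtz_def
    by (intro conjI ballI L2_diff L2 H1_0_diff H1_0 AE orth)
qed

text \<open>If \<mu> in the fine space competes for \<psi> and \<nu> in the coarse space competes
  for \<theta>, then \<mu> - \<nu> lies in the fine space by nestedness and competes for \<psi> -
  \<theta>. So the error of \<theta> may be measured in its own coarse space.\<close>

lemma best_err_diff_le:
  assumes V: "V \<subseteq> H1 \<Omega>" "W \<subseteq> V" "V \<noteq> {}" "W \<noteq> {}"
    and diff: "\<And>\<mu> \<nu>. \<mu> \<in> V \<Longrightarrow> \<nu> \<in> V \<Longrightarrow> (\<lambda>z. \<mu> z - \<nu> z) \<in> V"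
    and \<psi>: "\<psi> \<in> H1 \<Omega>" and \<theta>: "\<theta> \<in> H1 \<Omega>"
  shows "best_err \<Omega> V (\<lambda>z. \<psi> z - \<theta> z) \<le> best_err \<Omega> V \<psi> + best_err \<Omega> W \<theta>"
proof -
  define d where "d \<mu> \<psi> = L2_norm (lebesgue_on \<Omega>) (grad_perp \<Omega> (\<lambda>z. \<mu> z - \<psi> z))" for \<mu> \<psi>
  have be: "best_err \<Omega> V \<psi> = (INF \<mu>\<in>V. d \<mu> \<psi>)" for V \<psi>
    by (simp add: best_err_def d_def)
  have le: "best_err \<Omega> V (\<lambda>z. \<psi> z - \<theta> z) \<le> d \<mu> \<psi> + d \<nu> \<theta>" if \<mu>: "\<mu> \<in> V" and \<nu>: "\<nu> \<in> W" for \<mu> \<nu>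
  proof -
    have H1: "\<mu> \<in> H1 \<Omega>" "\<nu> \<in> H1 \<Omega>"
      using V \<mu> \<nu> by auto
    have "best_err \<Omega> V (\<lambda>z. \<psi> z - \<theta> z) \<le> d (\<lambda>z. \<mu> z - \<nu> z) (\<lambda>z. \<psi> z - \<theta> z)"
      unfolding be using V \<mu> \<nu>
      by (intro cINF_lower diff bdd_belowI[of _ 0]) (auto simp: d_def)
    also have "\<dots> = L2_norm (lebesgue_on \<Omega>) (grad_perp \<Omega> (\<lambda>z. (\<mu> z - \<psi> z) - (\<nu> z - \<theta> z)))"
      by (simp add: d_def algebra_simps)
    also have "\<dots> = L2_norm (lebesgue_on \<Omega>)
        (\<lambda>z. grad_perp \<Omega> (\<lambda>z. \<mu> z - \<psi> z) z - grad_perp \<Omega> (\<lambda>z. \<nu> z - \<theta> z) z)"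
      by (intro L2_norm_cong_AE AE_grad_perp_diff L2_measurable L2_diff grad_perp_L2 H1_diff H1 \<psi> \<theta>)
    also have "\<dots> \<le> d \<mu> \<psi> + d \<nu> \<theta>"
      unfolding d_def by (intro L2_norm_diff_le grad_perp_L2 H1_diff H1 \<psi> \<theta>)
    finally show ?thesis .
  qed
  \<comment> \<open>The two infima are taken in turn: first over \<mu> with \<nu> fixed, then over
    \<nu>.\<close>
  have "best_err \<Omega> V (\<lambda>z. \<psi> z - \<theta> z) - d \<nu> \<theta> \<le> best_err \<Omega> V \<psi>" if "\<nu> \<in> W" for \<nu>
    unfolding be[of V \<psi>] using le[OF _ that] by (intro cINF_greatest V) (simp add: algebra_simps)
  then have "best_err \<Omega> V (\<lambda>z. \<psi> z - \<theta> z) - best_err \<Omega> V \<psi> \<le> best_err \<Omega> W \<theta>"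
    unfolding be[of W \<theta>] by (intro cINF_greatest V) (simp add: algebra_simps)
  then show ?thesis
    by simp
qed

end

subsection \<open>Convergence of the fluxes\<close>

theorem theorem5p11:
  fixes \<Omega> \<Gamma>I \<Gamma>C :: "(real \<times> real) set"
    and f :: "real \<Rightarrow> real \<times> real"
    and r g uhat q \<psi> :: "real \<times> real \<Rightarrow> real"
    and U VC VI :: "real \<Rightarrow> (real \<times> real \<Rightarrow> real) set"
    and u qu \<psi>u :: "real \<Rightarrow> real \<times> real \<Rightarrow> real"
    and h0 C c \<kappa> \<gamma> :: real
  assumes domain: "open \<Omega>" "bounded \<Omega>" "simply_connected \<Omega>" "lipschitz_boundary \<Omega>"
    and boundary_parts:
      "openin (top_of_set (frontier \<Omega>)) \<Gamma>I" "openin (top_of_set (frontier \<Omega>)) \<Gamma>C"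
      "\<Gamma>I \<inter> \<Gamma>C = {}" "frontier \<Omega> = closure \<Gamma>I \<union> closure \<Gamma>C"
      "emeasure arc_length \<Gamma>I > 0" "emeasure arc_length \<Gamma>C > 0"
      "finite (components \<Gamma>I)" "finite (components \<Gamma>C)"
    and data: "locally_lipschitz f" "r \<in> L2 (lebesgue_on \<Omega>)" "g \<in> Linf (arc_length_on \<Gamma>I)"
    and solution: "weak_solution \<Omega> \<Gamma>I \<Gamma>C f r g uhat" "helmholtz \<Omega> \<Gamma>I \<Gamma>C (f \<circ> uhat) q \<psi>"
    and h0: "h0 > 0"
    and spaces:
      "\<And>h. h \<in> mesh h0 \<Longrightarrow> findim_subspace \<Omega> (Linf (lebesgue_on \<Omega>)) (U h)"
      "\<And>h. h \<in> mesh h0 \<Longrightarrow> findim_subspace \<Omega> (H1_0 \<Omega> \<Gamma>C) (VC h)"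
      "\<And>h. h \<in> mesh h0 \<Longrightarrow> findim_subspace \<Omega> (H1_0 \<Omega> \<Gamma>I) (VI h)"
    and minimizer:
      "\<And>h. h \<in> mesh h0 \<Longrightarrow> is_arg_min (LSG \<Omega> f q (VC h) (VI h)) (\<lambda>v. v \<in> U h) (u h)"
    and decomposition:
      "\<And>h. h \<in> mesh h0 \<Longrightarrow> helmholtz \<Omega> \<Gamma>I \<Gamma>C (f \<circ> u h) (qu h) (\<psi>u h)"
    and constants: "C > 0" "c > 0" "\<kappa> > 0" "\<gamma> > 0" "\<kappa> > \<gamma>"
    and rate:
      "\<And>h. h \<in> mesh h0 \<Longrightarrow>
         dual_norm \<Omega> \<Gamma>C (\<lambda>\<phi>. dual_div \<Omega> (f \<circ> u h) \<phi> - data_functional \<Omega> \<Gamma>I f r g \<phi>)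
           \<le> ennreal (C * h powr \<kappa>)"
    and inf_sup:
      "\<And>h. h \<in> mesh h0 \<Longrightarrow> 2 * h \<in> mesh h0 \<Longrightarrow>
         (INF s\<in>{s \<in> restricted_flux_span \<Omega> \<Gamma>I \<Gamma>C f (U h) (VI h)
                        (2 * best_err \<Omega> (VI (2 * h)) (\<psi>u (2 * h))).
                 nonzero (lebesgue_on \<Omega>) s}.
            SUP p\<in>{p \<in> H1_0 \<Omega> \<Gamma>C. nonzero (lebesgue_on \<Omega>) p}.
              ennreal (\<bar>L2_inner (lebesgue_on \<Omega>) s (grad \<Omega> p)\<bar>
                / (L2_norm (lebesgue_on \<Omega>) s * L2_norm (lebesgue_on \<Omega>) (grad \<Omega> p))))
         \<ge> ennreal (c * h powr \<gamma>)"
    and nested: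
      "\<And>h. h \<in> mesh h0 \<Longrightarrow> 2 * h \<in> mesh h0 \<Longrightarrow> U (2 * h) \<subseteq> U h"
      "\<And>h. h \<in> mesh h0 \<Longrightarrow> 2 * h \<in> mesh h0 \<Longrightarrow> VI (2 * h) \<subseteq> VI h"
    and error_decreasing:
      "\<exists>h1>0. \<forall>h\<in>mesh h0. h < h1 \<and> 2 * h \<in> mesh h0 \<longrightarrow>
         best_err \<Omega> (VI h) (\<psi>u h) \<le> best_err \<Omega> (VI (2 * h)) (\<psi>u (2 * h))"
  shows "\<exists>w\<in>L2 (lebesgue_on \<Omega>). \<exists>C'>0. \<exists>h1>0. \<forall>h\<in>mesh h0. h < h1 \<longrightarrow>
           L2_norm (lebesgue_on \<Omega>) (\<lambda>z. f (u h z) - w z) \<le> C' * h powr (\<kappa> - \<gamma>)"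
proof -
  interpret bounded_domain \<Omega>
    using domain by unfold_locales
  let ?M = "lebesgue_on \<Omega>"
  define R where "R h = best_err \<Omega> (VI h) (\<psi>u h)" for h
  \<comment> \<open>The residual bounds at \<open>h\<close> and \<open>2 * h\<close> add up to C (1
    + 2 powr \<kappa>) h powr \<kappa>, and the inf-sup condition divides this by c h powr
    \<gamma>.\<close>
  define D where "D = C * (1 + 2 powr \<kappa>) / c"
  have D: "D > 0"
    using constants by (simp add: D_def add_pos_nonneg)
  have flux_L2: "(\<lambda>z. f (u h z)) \<in> L2 ?M" if "h \<in> mesh h0" for h
    using decomposition[OF that] by (simp add: helmholtz_def comp_def)
  obtain h1 where h1: "h1 > 0"
    and R_mono: "\<And>h. h \<in> mesh h0 \<Longrightarrow> h < h1 \<Longrightarrow> 2 * h \<in> mesh h0 \<Longrightarrow> R h \<le> R (2 * h)"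
    using error_decreasing unfolding R_def by blast
  have step: "L2_norm ?M (\<lambda>z. f (u h z) - f (u (2 * h) z)) \<le> D * h powr (\<kappa> - \<gamma>)"
    if h: "h \<in> mesh h0" and h2: "2 * h \<in> mesh h0" and "h < h1" for h
  proof -
    let ?s = "\<lambda>z. f (u h z) - f (u (2 * h) z)"
    have "h > 0"
      using h h0 by (auto simp: mesh_def)
    have s_L2: "?s \<in> L2 ?M"
      by (intro L2_diff flux_L2 h h2)
    have helm: "helmholtz \<Omega> \<Gamma>I \<Gamma>C ?s (\<lambda>z. qu h z - qu (2 * h) z) (\<lambda>z. \<psi>u h z - \<psi>u (2 * h) z)"
      using helmholtz_diff[OF decomposition[OF h] decomposition[OF h2]] by (simp add: comp_def)
    have "u h \<in> U h" "u (2 * h) \<in> U h"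
      using minimizer[OF h] minimizer[OF h2] nested(1)[OF h h2] by (auto simp: is_arg_min_def)
    then have s_span: "?s \<in> flux_span f (U h)"
      by (rule flux_span_diff)
    have \<psi>_H1_0: "\<psi>u h \<in> H1_0 \<Omega> \<Gamma>I" "\<psi>u (2 * h) \<in> H1_0 \<Omega> \<Gamma>I"
      using decomposition[OF h] decomposition[OF h2] by (simp_all add: helmholtz_def)
    have "best_err \<Omega> (VI h) (\<lambda>z. \<psi>u h z - \<psi>u (2 * h) z) \<le> R h + R (2 * h)"
      unfolding R_def
    proof (rule best_err_diff_le)
      show "VI h \<subseteq> H1 \<Omega>"
        using spaces(3)[OF h] H1_0_H1 by (auto simp: findim_subspace_def)
      \<comment> \<open>The stream functions themselves witness that the ambient space
        \<open>H1_0 \<Omega> \<Gamma>I\<close> is nonempty.\<close>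
      show "VI h \<noteq> {}" "VI (2 * h) \<noteq> {}"
        using findim_subspace_nonempty[OF spaces(3)[OF h] H1_0_diff]
          findim_subspace_nonempty[OF spaces(3)[OF h2] H1_0_diff] \<psi>_H1_0 by blast+
      show "(\<lambda>z. \<mu> z - \<nu> z) \<in> VI h" if "\<mu> \<in> VI h" "\<nu> \<in> VI h" for \<mu> \<nu>
        using that by (intro findim_subspace_diff[OF spaces(3)[OF h]] H1_0_diff)
    qed (use \<psi>_H1_0 H1_0_H1 nested(2)[OF h h2] in auto)
    also have "\<dots> \<le> 2 * best_err \<Omega> (VI (2 * h)) (\<psi>u (2 * h))"
      using R_mono[OF h \<open>h < h1\<close> h2] by (simp add: R_def)
    finally have s_restricted: "?s \<in> restricted_flux_span \<Omega> \<Gamma>I \<Gamma>C f (U h) (VI h)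
        (2 * best_err \<Omega> (VI (2 * h)) (\<psi>u (2 * h)))"
      using helm s_span unfolding restricted_flux_span_def by blast
    define E where "E = C * h powr \<kappa> + C * (2 * h) powr \<kappa>"
    have "c * h powr \<gamma> * L2_norm ?M ?s \<le> E"
    proof (rule inf_sup_norm_le[OF inf_sup[OF h h2] s_restricted s_L2])
      show "0 \<le> E"
        using constants by (simp add: E_def)
      fix p assume p: "p \<in> {p \<in> H1_0 \<Omega> \<Gamma>C. nonzero ?M p}"
      define residual where
        "residual v = dual_div \<Omega> (f \<circ> v) p - data_functional \<Omega> \<Gamma>I f r g p" for v
      have residual_le: "\<bar>residual (u k)\<bar> / L2_norm ?M (grad \<Omega> p) \<le> C * k powr \<kappa>"
        if "k \<in> mesh h0" for k
        unfolding residual_def using p constants by (intro dual_norm_leD[OF rate[OF that]]) auto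
      \<comment> \<open>The minus sign in \<open>dual_div\<close> reverses the order of the two
        levels.\<close>
      have "L2_inner ?M ?s (grad \<Omega> p) = residual (u (2 * h)) - residual (u h)"
        using p L2_inner_diff_left[OF flux_L2[OF h] flux_L2[OF h2] grad_L2[OF H1_0_H1], of p \<Gamma>C]
        by (simp add: residual_def dual_div_def comp_def)
      then have "\<bar>L2_inner ?M ?s (grad \<Omega> p)\<bar> / L2_norm ?M (grad \<Omega> p)
          \<le> (\<bar>residual (u h)\<bar> + \<bar>residual (u (2 * h))\<bar>) / L2_norm ?M (grad \<Omega> p)"
        by (intro divide_right_mono) auto
      also have "\<dots> \<le> E"
        using residual_le[OF h] residual_le[OF h2] by (simp add: E_def add_divide_distrib)
      finally show "\<bar>L2_inner ?M ?s (grad \<Omega> p)\<bar> / L2_norm ?M (grad \<Omega> p) \<le> E" .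
    qed
    then have "L2_norm ?M ?s \<le> E / (c * h powr \<gamma>)"
      using constants \<open>h > 0\<close> by (simp add: field_simps)
    also have "\<dots> = D * h powr (\<kappa> - \<gamma>)"
      using \<open>h > 0\<close> by (simp add: E_def D_def powr_mult powr_diff field_simps)
    finally show ?thesis .
  qed
  define \<alpha> where "\<alpha> = \<kappa> - \<gamma>"
  \<comment> \<open>The factor gained by \<open>h powr \<alpha>\<close> when \<open>h\<close> is
    halved; it is below 1 because \<kappa> > \<gamma>.\<close>
  define \<rho> where "\<rho> = (1 / 2 :: real) powr \<alpha>"
  have \<rho>: "0 < \<rho>" "\<rho> < 1"
    using constants powr_less_mono'[of "1 / 2" 0 \<alpha>] by (auto simp: \<rho>_def \<alpha>_def)
  have mesh_powr: "(h0 / 2 ^ k) powr \<alpha> = h0 powr \<alpha> * \<rho> ^ k" for k :: nat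
  proof -
    have "(h0 / 2 ^ k) powr \<alpha> = h0 powr \<alpha> * ((1 / 2) ^ k) powr \<alpha>"
      using h0 by (simp add: powr_mult[symmetric] power_one_over)
    also have "((1 / 2 :: real) ^ k) powr \<alpha> = \<rho> ^ k"
      by (simp add: \<rho>_def powr_realpow[symmetric] powr_powr mult.commute)
    finally show ?thesis .
  qed
  have mesh: "h0 / 2 ^ k \<in> mesh h0" for k
    unfolding mesh_def by (rule rangeI)
  \<comment> \<open>The best approximation errors are known to decrease only for meshes below
    \<open>h1\<close>, so the sequence of fluxes is started at a level \<open>K\<close> already
    below it.\<close>
  obtain K where K: "(1 / 2) ^ K < h1 / h0"
    using real_arch_pow_inv[of "h1 / h0" "1 / 2"] h0 h1 by auto
  define v where "v k = (\<lambda>z. f (u (h0 / 2 ^ (K + k)) z))" for k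
  \<comment> \<open>The increment between levels \<open>K + k\<close> and \<open>K + k + 1\<close>
    is bounded in terms of the finer mesh, hence the exponent \<open>Suc K\<close>.\<close>
  define A where "A = D * h0 powr \<alpha> * \<rho> ^ Suc K"
  have v_step: "L2_norm ?M (\<lambda>z. v (Suc k) z - v k z) \<le> A * \<rho> ^ k" for k
  proof -
    define h where "h = h0 / 2 ^ Suc (K + k)"
    have h2: "2 * h = h0 / 2 ^ (K + k)"
      by (simp add: h_def)
    have "(1 / 2) ^ Suc (K + k) \<le> (1 / 2 :: real) ^ K"
      by (intro power_decreasing) auto
    then have "h0 * (1 / 2) ^ Suc (K + k) \<le> h0 * (1 / 2) ^ K"
      using h0 by (intro mult_left_mono) auto
    moreover have "h0 * (1 / 2) ^ K < h1"
      using K h0 by (simp add: field_simps)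
    ultimately have "h < h1"
      by (simp add: h_def power_one_over)
    then have "L2_norm ?M (\<lambda>z. f (u h z) - f (u (2 * h) z)) \<le> D * h powr \<alpha>"
      unfolding \<alpha>_def using mesh by (intro step) (simp_all only: h2, simp_all only: h_def)
    also have "D * h powr \<alpha> = A * \<rho> ^ k"
      unfolding h_def mesh_powr A_def by (simp add: power_add)
    finally show ?thesis
      unfolding h2 by (simp add: v_def h_def)
  qed
  obtain w where w: "w \<in> L2 ?M"
    "\<And>k. L2_norm ?M (\<lambda>z. v k z - w z) \<le> A * \<rho> ^ k / (1 - \<rho>)"
    using L2_geometric_limit[of v ?M A \<rho>] v_step \<rho> D flux_L2[OF mesh] by (auto simp: v_def A_def)
  \<comment> \<open>The increments beyond mesh \<open>h\<close> are at most D \<rho> ^ i h powr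
    \<alpha> for i = 1, 2, and so on; their geometric sum gives the constant D \<rho> / (1 -
    \<rho>).\<close>
  have "L2_norm ?M (\<lambda>z. f (u h z) - w z) \<le> D * \<rho> / (1 - \<rho>) * h powr (\<kappa> - \<gamma>)"
    if h: "h \<in> mesh h0" "h < h0 / 2 ^ K" for h
  proof -
    obtain k where k: "h = h0 / 2 ^ k"
      using h(1) by (auto simp: mesh_def)
    have "(2 :: real) ^ K < 2 ^ k"
      using h(2) h0 unfolding k by (simp add: field_simps)
    then have "K < k"
      by simp
    then obtain j where j: "k = K + j"
      using less_imp_add_positive by blast
    have "L2_norm ?M (\<lambda>z. f (u h z) - w z) \<le> A * \<rho> ^ j / (1 - \<rho>)"
      using w(2)[of j] by (simp add: v_def k j)
    also have "\<dots> = D * \<rho> / (1 - \<rho>) * h powr \<alpha>"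
      unfolding k j mesh_powr A_def by (simp add: power_add)
    finally show ?thesis
      by (simp add: \<alpha>_def)
  qed
  moreover have "D * \<rho> / (1 - \<rho>) > 0" "h0 / 2 ^ K > 0"
    using D \<rho> h0 by simp_all
  ultimately show ?thesis
    using w(1) by blast
qed

end
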